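(* Let $d\geq 4$, let $\mathbb{X}^d=\mathbb{R}^d$ or $\mathbb{X}^d=\mathbb{C}^d$, let $\{b_1,\ldots,b_d\}$ be a random orthonormal basis of $\mathbb{X}^d$ with distribution $u_{ONB(\mathbb{X}^d)}$, and let $\varphi\in L^2(\mathbb{S}(\mathbb{X}^d),u,\mathbb{R})$. Then $$\Bigl|\operatorname{Cov}\bigl(\varphi(b_1),\varphi(b_2)\bigr)\Bigr|\leq\frac{1}{d-1}\operatorname{Var}_u(\varphi).$$ The estimate is sharp in the sense that for every such $d$ there exists a $\varphi$ for which equality holds.
   Context: $\mathbb{S}(\mathbb{X}^d)$ is the unit sphere of $\mathbb{X}^d$ (with its standard inner product); $u$ is the uniform probability measure (normalized surface area) on $\mathbb{S}(\mathbb{X}^d)$; $L^2(\mathbb{S}(\mathbb{X}^d),u,\mathbb{R})$ is the space of real-valued square-integrable functions with respect to $u$; $\operatorname{Var}_u(\varphi)$ is the variance of $\varphi$ with respect to $u$; $\operatorname{Cov}$ is the covariance of random variables. $G$ is the orthogonal group $O(d)$ if $\mathbb{X}^d=\mathbb{R}^d$ and the unitary group $U(d)$ if $\mathbb{X}^d=\mathbb{C}^d$. The uniform distribution $u_{ONB(\mathbb{X}^d)}$ over (ordered) orthonormal bases of $\mathbb{X}^d$ is the distribution of $(R(e_1),\ldots,R(e_d))$, where $(e_1,\ldots,e_d)$ is any fixed orthonormal basis and $R$ is a random element of $G$ distributed according to normalized Haar measure; it does not depend on the choice of the fixed basis. *)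

theory Defs
  imports "HOL-Probability.Probability"
begin

text \<open>
  Surface area of the unit sphere in polar coordinates: a Borel subset \<open>E\<close> of the sphere has
  area \<open>DIM('a)\<close> times the volume of the punctured cone \<open>{r *\<^sub>R x | r x. 0 < r \<and> r \<le> 1 \<and> x \<in> E}\<close>,
  which is the preimage of \<open>E\<close> under \<open>sgn x = x /\<^sub>R norm x\<close> in the punctured unit ball. On
  \<open>complex ^ 'n\<close> the Lebesgue measure and the norm are those of the underlying real space of
  dimension \<open>2 * CARD('n)\<close>; this norm is the one of the Hermitian inner product.
\<close>

definition sphere_area :: "'a::euclidean_space measure" where
  "sphere_area = scale_measure (of_nat DIM('a))
     (distr (restrict_space lborel (cball 0 1 - {0})) (restrict_space borel (sphere 0 1)) sgn)"

definition uniform_sphere :: "'a::euclidean_space measure" where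
  "uniform_sphere = uniform_measure sphere_area (sphere 0 1)"

text \<open>
  Square-integrable functions are represented by functions, not by classes modulo null sets;
  the values outside \<open>space M\<close> are irrelevant.
\<close>

definition L2_real :: "'a measure \<Rightarrow> ('a \<Rightarrow> real) set" where
  "L2_real M = {f \<in> borel_measurable M. integrable M (\<lambda>x. (f x)\<^sup>2)}"

definition covariance :: "'a measure \<Rightarrow> ('a \<Rightarrow> real) \<Rightarrow> ('a \<Rightarrow> real) \<Rightarrow> real" where
  "covariance M X Y =
     (LINT \<omega>|M. (X \<omega> - (LINT \<omega>'|M. X \<omega>')) * (Y \<omega> - (LINT \<omega>'|M. Y \<omega>')))"

definition cinner_vec :: "complex ^ 'n \<Rightarrow> complex ^ 'n \<Rightarrow> complex" where
  "cinner_vec x y = (\<Sum>k\<in>UNIV. cnj (x $ k) * y $ k)"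

definition adjoint_matrix :: "complex ^ 'n ^ 'm \<Rightarrow> complex ^ 'm ^ 'n" where
  "adjoint_matrix A = (\<chi> i j. cnj (A $ j $ i))"

definition unitary_matrix :: "complex ^ 'n ^ 'n \<Rightarrow> bool" where
  "unitary_matrix A \<longleftrightarrow> adjoint_matrix A ** A = mat 1 \<and> A ** adjoint_matrix A = mat 1"

definition orthogonal_group :: "(real ^ 'n ^ 'n) set" where
  "orthogonal_group = {A. orthogonal_matrix A}"

definition unitary_group :: "(complex ^ 'n ^ 'n) set" where
  "unitary_group = {A. unitary_matrix A}"

text \<open>
  For a compact matrix group \<open>G\<close> there is exactly one such measure.
\<close>

definition normalized_haar ::
    "(('a::{semiring_1,topological_space}) ^ 'n ^ 'n) set \<Rightarrow> ('a ^ 'n ^ 'n) measure \<Rightarrow> bool" where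
  "normalized_haar G \<mu> \<longleftrightarrow>
     sets \<mu> = sets (restrict_space borel G) \<and> prob_space \<mu> \<and>
     (\<forall>g\<in>G. \<forall>A\<in>sets \<mu>. emeasure \<mu> ((\<lambda>x. g ** x) ` A) = emeasure \<mu> A)"

text \<open>
  An ordered family \<open>b\<close> of vectors of \<open>'a ^ 'n\<close> indexed by \<open>'n\<close> is a vector of vectors, its
  \<open>i\<close>-th member being \<open>b $ i\<close>. Since the family has as many members as the dimension, it is a
  basis as soon as it is orthonormal. The parameter \<open>ip\<close> is the inner product.
\<close>

definition onb :: "('a ^ 'n \<Rightarrow> 'a ^ 'n \<Rightarrow> 'a::semiring_1) \<Rightarrow> ('a ^ 'n ^ 'n) set" where
  "onb ip = {b. \<forall>i j. ip (b $ i) (b $ j) = (if i = j then 1 else 0)}"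

definition onb_space ::
    "('a ^ 'n \<Rightarrow> 'a ^ 'n \<Rightarrow> 'a::{semiring_1,topological_space}) \<Rightarrow> ('a ^ 'n ^ 'n) measure" where
  "onb_space ip = restrict_space borel (onb ip)"

definition uniform_random_onb ::
    "('a ^ 'n \<Rightarrow> 'a ^ 'n \<Rightarrow> 'a::{semiring_1,topological_space}) \<Rightarrow> ('a ^ 'n ^ 'n) set \<Rightarrow>
     'w measure \<Rightarrow> ('w \<Rightarrow> 'a ^ 'n ^ 'n) \<Rightarrow> bool" where
  "uniform_random_onb ip G M b \<longleftrightarrow>
     prob_space M \<and> b \<in> measurable M (onb_space ip) \<and>
     (\<exists>\<mu>. normalized_haar G \<mu> \<and>
        distr M (onb_space ip) b = distr \<mu> (onb_space ip) (\<lambda>R. \<chi> i. R *v axis i 1))"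

end

theory Submission
  imports Defs
begin

text \<open>
  Write \<open>b\<^sub>k = R e\<^sub>k\<close> with \<open>R\<close> Haar distributed. The bilinear form \<open>E (f (b\<^sub>i) g (b\<^sub>j))\<close> is
  \<open>\<langle>T f, g\<rangle>\<close> for a self-adjoint operator \<open>T\<close> on \<open>L\<^sup>2\<close>: \<open>T f (y)\<close> is the mean of \<open>f\<close> over the unit
  vectors orthogonal to \<open>y\<close>. For \<open>f x = \<bar>\<langle>a, x\<rangle>\<bar> ^ (2 l)\<close>, invariance gives
  \<open>T f (y) = c\<^sub>l (\<bar>a\<bar>\<^sup>2 - \<bar>\<langle>a, y\<rangle>\<bar>\<^sup>2) ^ l\<close>, where \<open>c\<^sub>l\<close> is the mean of \<open>\<bar>x\<^sub>1\<bar> ^ (2 l)\<close> over a unit sphere one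
  dimension lower. So \<open>T\<close> is triangular on the span of these functions, with diagonal entries
  \<open>(- 1) ^ l c\<^sub>l\<close>, and \<open>\<bar>x\<^sub>1\<bar> ^ (2 l) + \<bar>x\<^sub>2\<bar> ^ (2 l) + \<dots> \<le> 1\<close> shows \<open>c\<^sub>l \<le> 1 / (d - 1)\<close> for \<open>l \<ge> 1\<close>. Being
  self-adjoint, \<open>T\<close> is diagonal after orthogonalization. It maps the powers of
  \<open>Re \<langle>a, x\<rangle>\<close>, whose span is dense in \<open>L\<^sup>2\<close>, into this span. Equality holds for \<open>l = 1\<close>.
\<close>

section \<open>The uniform measure on the sphere\<close>

text \<open>The functions attached to different directions \<open>a\<close> are not orthogonal to
  each other, so their spans cannot be treated separately. Instead of decomposing L2 into invariant
  subspaces, a finite-dimensional subspace on which the inequality is known is enlarged by one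
  function at a time; only the part of the new function orthogonal to the old subspace matters, and
  directions may be mixed freely. \<open>T\<close> need not be constructed on all of L2: knowing the
  bilinear form on the adjoined functions is enough. Centering is essential: \<open>T\<close> fixes
  the constants, and this value 1 would break the bound, whereas the covariance of a constant with
  anything is 0. Even powers of \<open>Re <a, x>\<close> are sent by \<open>T\<close> into the span
  of the even powers of the modulus, so once these are present such a power enters with scalar 0;
  for odd powers the form vanishes. Integrals over the sphere of a hyperplane are avoided by
  projecting a uniform vector of the full sphere to the hyperplane and dividing by the moment of the
  length of the projection. Haar measure is given by left invariance, but a change of the fixed
  basis acts from the right; hence the detour through inversion.\<close>

lemma nn_integral_lborel_translate:
  fixes c :: "'a::euclidean_space"
  assumes [measurable]: "f \<in> borel_measurable borel"
  shows "(\<integral>\<^sup>+x. f (x + c) \<partial>lborel) = (\<integral>\<^sup>+x. f x \<partial>lborel)"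
proof -
  have "(\<integral>\<^sup>+x. f x \<partial>lborel) = (\<integral>\<^sup>+x. f x \<partial>distr lborel borel ((+) c))"
    by (simp add: lborel_distr_plus)
  also have "\<dots> = (\<integral>\<^sup>+x. f (x + c) \<partial>lborel)"
    by (subst nn_integral_distr) (auto simp: add.commute)
  finally show ?thesis ..
qed

lemma emeasure_lborel_open_neq_0:
  fixes U :: "'a::euclidean_space set"
  assumes "open U" "U \<noteq> {}"
  shows "emeasure lborel U \<noteq> 0"
  using open_not_negligible[OF assms] null_sets_completionI[of U lborel] assms(1)
  by (auto simp: negligible_iff_null_sets null_sets_def)

text \<open>
  The image measure is translation invariant, hence proportional to \<open>lborel\<close>; Fubini's theorem
  identifies the factor by comparison on the unit ball, which the isometry preserves.
\<close>

lemma distr_lborel_isometry: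
  fixes f :: "'a::euclidean_space \<Rightarrow> 'a"
  assumes lin: "linear f" and iso: "\<And>x. norm (f x) = norm x"
  shows "distr lborel borel f = lborel"
proof -
  have "inj f"
    using iso by (auto simp: linear_injective_0[OF lin]) (metis norm_eq_zero)
  then have "surj f"
    using linear_injective_imp_surjective[OF lin] by simp
  have [measurable]: "f \<in> borel_measurable borel"
    using linear_continuous_on[OF linear_conv_bounded_linear[THEN iffD1, OF lin]]
    by (intro borel_measurable_continuous_onI)
  have [measurable]: "ball (0::'a) 1 \<in> sets borel" by simp
  let ?B = "indicator (ball (0::'a) 1) :: 'a \<Rightarrow> ennreal"
  have pos: "emeasure lborel (ball (0::'a) 1) \<noteq> 0"
    by (rule emeasure_lborel_open_neq_0) auto
  show ?thesis
  proof (rule measure_eqI)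
    fix A assume "A \<in> sets (distr lborel borel f)"
    then have [measurable]: "A \<in> sets borel" by simp
    have trans: "(\<integral>\<^sup>+x. indicator A (f x + y) \<partial>lborel) = emeasure (distr lborel borel f) A" for y
    proof -
      obtain y' where y: "y = f y'" using \<open>surj f\<close> by auto
      have "(\<integral>\<^sup>+x. indicator A (f x + y) \<partial>lborel) = (\<integral>\<^sup>+x. indicator A (f (x + y')) \<partial>lborel)"
        by (simp add: y linear_add[OF lin])
      also have "\<dots> = (\<integral>\<^sup>+x. indicator A (f x) \<partial>lborel)"
        by (rule nn_integral_lborel_translate[of "\<lambda>x. indicator A (f x)"]) measurable
      also have "\<dots> = (\<integral>\<^sup>+x. indicator A x \<partial>distr lborel borel f)"
        by (subst nn_integral_distr) auto
      finally show ?thesis by simp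
    qed
    have ball: "(\<integral>\<^sup>+x. ?B (y - f x) \<partial>lborel) = emeasure lborel (ball (0::'a) 1)" for y
    proof -
      obtain y' where y: "y = f y'" using \<open>surj f\<close> by auto
      have "?B (y - f x) = ?B (x + (- y'))" for x
        by (simp add: y linear_diff[OF lin, symmetric] indicator_def iso norm_minus_commute)
      then have "(\<integral>\<^sup>+x. ?B (y - f x) \<partial>lborel) = (\<integral>\<^sup>+x. ?B (x + (- y')) \<partial>lborel)"
        by simp
      also have "\<dots> = (\<integral>\<^sup>+x. ?B x \<partial>lborel)"
        by (rule nn_integral_lborel_translate) measurable
      finally show ?thesis by simp
    qed
    \<comment> \<open>The double integral of \<open>indicator A (f x + y) * ?B y\<close> is computed
      twice. Integrating over \<open>x\<close> first gives the left side, by \<open>trans\<close>;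
      substituting \<open>y - f x\<close> for \<open>y\<close> and then integrating over
      \<open>x\<close> gives the right side, by \<open>ball\<close>.\<close>
    have "emeasure (distr lborel borel f) A * emeasure lborel (ball (0::'a) 1)
        = (\<integral>\<^sup>+y. (\<integral>\<^sup>+x. indicator A (f x + y) \<partial>lborel) * ?B y \<partial>lborel)"
      by (simp add: trans nn_integral_cmult_indicator)
    also have "\<dots> = (\<integral>\<^sup>+y. (\<integral>\<^sup>+x. indicator A (f x + y) * ?B y \<partial>lborel) \<partial>lborel)"
      by (simp add: nn_integral_multc)
    also have "\<dots> = (\<integral>\<^sup>+x. (\<integral>\<^sup>+y. indicator A (f x + y) * ?B y \<partial>lborel) \<partial>lborel)"
      by (rule lborel_pair.Fubini') measurable
    also have "\<dots> = (\<integral>\<^sup>+x. (\<integral>\<^sup>+y. indicator A y * ?B (y - f x) \<partial>lborel) \<partial>lborel)"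
    proof (rule nn_integral_cong)
      fix x
      show "(\<integral>\<^sup>+y. indicator A (f x + y) * ?B y \<partial>lborel) = (\<integral>\<^sup>+y. indicator A y * ?B (y - f x) \<partial>lborel)"
        using nn_integral_lborel_translate[of "\<lambda>y. indicator A y * ?B (y - f x)" "f x"]
        by (simp add: add.commute)
    qed
    also have "\<dots> = (\<integral>\<^sup>+y. (\<integral>\<^sup>+x. indicator A y * ?B (y - f x) \<partial>lborel) \<partial>lborel)"
      by (rule lborel_pair.Fubini') measurable
    also have "\<dots> = emeasure lborel A * emeasure lborel (ball (0::'a) 1)"
      by (simp add: nn_integral_cmult ball nn_integral_multc)
    finally show "emeasure (distr lborel borel f) A = emeasure lborel A"
      using pos emeasure_lborel_ball_finite[of "0::'a" 1]
      by (auto simp: mult.commute[of _ "emeasure lborel (ball (0::'a) 1)"] ennreal_mult_cancel_left)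
  qed simp
qed

lemma sets_sphere_area:
  "sets (sphere_area :: 'a::euclidean_space measure) = sets (restrict_space borel (sphere 0 1))"
  by (simp add: sphere_area_def)

lemma sets_uniform_sphere [measurable_cong]:
    "sets (uniform_sphere :: 'a::euclidean_space measure) = sets (restrict_space borel (sphere 0 1))"
  and space_uniform_sphere [simp]: "space (uniform_sphere :: 'a measure) = sphere 0 1"
  by (simp_all add: uniform_sphere_def sphere_area_def space_restrict_space space_scale_measure)

lemma sgn_measurable_sphere [measurable]:
  "(sgn :: 'a::euclidean_space \<Rightarrow> 'a) \<in>
     restrict_space lborel (cball 0 1 - {0}) \<rightarrow>\<^sub>M restrict_space borel (sphere 0 1)"
  by (rule measurable_restrict_space2)
     (auto simp: space_restrict_space norm_sgn sgn_div_norm intro!: measurable_restrict_space1)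

lemma emeasure_sphere_area:
  assumes "A \<in> sets (restrict_space borel (sphere (0::'a::euclidean_space) 1))"
  shows "emeasure sphere_area A = of_nat DIM('a) * emeasure lborel (sgn -` A \<inter> (cball 0 1 - {0}))"
  unfolding sphere_area_def using assms
  by (simp add: emeasure_distr space_restrict_space emeasure_restrict_space)

text \<open>The total area is the dimension times the volume of the unit ball, hence finite and
  nonzero; the removed origin has volume 0.\<close>

lemma prob_space_uniform_sphere: "prob_space (uniform_sphere :: 'a::euclidean_space measure)"
proof -
  have S: "sphere 0 1 \<in> sets (restrict_space borel (sphere (0::'a) 1))"
    by (metis sets.top space_restrict_space2 space_borel sets_borel Int_UNIV_right space_restrict_space)
  have "sgn -` sphere 0 1 \<inter> (cball 0 1 - {0}) = cball (0::'a) 1 - {0}"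
    by (auto simp: norm_sgn)
  moreover have "emeasure lborel (cball (0::'a) 1 - {0}) = emeasure lborel (cball (0::'a) 1)"
    by (subst emeasure_Diff) auto
  moreover have "emeasure lborel (cball (0::'a) 1) \<noteq> 0"
    using emeasure_lborel_open_neq_0[of "ball (0::'a) 1"]
      emeasure_mono[OF ball_subset_cball, of "0::'a" 1 lborel] by auto
  moreover have "emeasure lborel (cball (0::'a) 1) < \<infinity>"
    by (rule emeasure_lborel_cball_finite)
  ultimately show ?thesis
    unfolding uniform_sphere_def
    by (intro prob_space_uniform_measure) (auto simp: emeasure_sphere_area[OF S] ennreal_mult_eq_top_iff)
qed

lemma emeasure_uniform_sphere:
  assumes "A \<in> sets (uniform_sphere :: 'a::euclidean_space measure)"
  shows "emeasure uniform_sphere A =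
    of_nat DIM('a) * emeasure lborel (sgn -` A \<inter> (cball 0 1 - {0})) / emeasure (sphere_area :: 'a measure) (sphere 0 1)"
proof -
  have "A \<subseteq> sphere 0 1" using sets.sets_into_space[OF assms] by simp
  then have "sphere 0 1 \<inter> A = A" by blast
  then show ?thesis
    using assms unfolding uniform_sphere_def
    by (subst emeasure_uniform_measure)
       (auto simp: emeasure_sphere_area[of A] sets_sphere_area sets_restrict_space_iff)
qed

text \<open>\<open>sgn\<close> commutes with a linear isometry, so the punctured cone over a
  preimage is the preimage of the punctured cone, and the invariance of \<open>lborel\<close>
  carries over.\<close>

lemma distr_uniform_sphere_isometry:
  fixes f :: "'a::euclidean_space \<Rightarrow> 'a"
  assumes lin: "linear f" and iso: "\<And>x. norm (f x) = norm x"
  shows "distr uniform_sphere uniform_sphere f = uniform_sphere"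
proof -
  have [measurable]: "f \<in> borel_measurable borel"
    using linear_continuous_on[OF linear_conv_bounded_linear[THEN iffD1, OF lin]]
    by (intro borel_measurable_continuous_onI)
  have meas: "f \<in> (uniform_sphere :: 'a measure) \<rightarrow>\<^sub>M uniform_sphere"
    unfolding measurable_cong_sets[OF sets_uniform_sphere sets_uniform_sphere]
    by (rule measurable_restrict_space2)
       (auto simp: space_restrict_space iso intro!: measurable_restrict_space1)
  have sgn: "sgn (f x) = f (sgn x)" for x
    by (simp add: sgn_div_norm iso linear_scale[OF lin])
  have f0: "f x = 0 \<longleftrightarrow> x = 0" for x
    by (metis iso norm_eq_zero)
  show ?thesis
  proof (rule measure_eqI)
    fix A :: "'a set" assume "A \<in> sets (distr uniform_sphere uniform_sphere f)"
    then have A: "A \<in> sets (uniform_sphere :: 'a measure)" by simp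
    let ?S = "\<lambda>A. sgn -` A \<inter> (cball 0 1 - {0::'a})"
    have fA: "f -` A \<inter> sphere 0 1 \<in> sets (uniform_sphere :: 'a measure)"
      using measurable_sets[OF meas A] by simp
    have SA: "?S A \<in> sets borel"
    proof -
      have "?S A \<in> sets (restrict_space lborel (cball 0 1 - {0::'a}))"
        using measurable_sets[OF sgn_measurable_sphere, of A] A
        by (simp add: sets_uniform_sphere space_restrict_space)
      then show ?thesis by (simp add: sets_restrict_space_iff)
    qed
    have "?S (f -` A \<inter> sphere 0 1) = f -` ?S A"
      by (auto simp: sgn iso norm_sgn f0)
    then have "emeasure lborel (?S (f -` A \<inter> sphere 0 1)) = emeasure (distr lborel borel f) (?S A)"
      using SA by (simp add: emeasure_distr)
    also have "\<dots> = emeasure lborel (?S A)"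
      by (simp add: distr_lborel_isometry[OF lin iso])
    finally show "emeasure (distr uniform_sphere uniform_sphere f) A = emeasure uniform_sphere A"
      using A fA by (simp add: emeasure_distr[OF meas] emeasure_uniform_sphere)
  qed simp
qed

section \<open>Square-integrable functions\<close>

lemma L2_realD [measurable_dest]:
  assumes "f \<in> L2_real M"
  shows "f \<in> borel_measurable M" "integrable M (\<lambda>x. (f x)\<^sup>2)"
  using assms by (auto simp: L2_real_def)

lemma L2_real_mult_integrable:
  assumes "f \<in> L2_real M" "g \<in> L2_real M"
  shows "integrable M (\<lambda>x. f x * g x)"
proof (rule Bochner_Integration.integrable_bound)
  show "integrable M (\<lambda>x. (f x)\<^sup>2 + (g x)\<^sup>2)"
    using assms by (auto dest: L2_realD)
  show "(\<lambda>x. f x * g x) \<in> borel_measurable M"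
    using assms[THEN L2_realD(1)] by auto
  have "\<bar>a * b\<bar> \<le> a\<^sup>2 + b\<^sup>2" for a b :: real
    using sum_squares_bound[of "\<bar>a\<bar>" "\<bar>b\<bar>"] mult_nonneg_nonneg[of "\<bar>a\<bar>" "\<bar>b\<bar>"]
    unfolding abs_mult power2_abs by linarith
  then show "AE x in M. norm (f x * g x) \<le> norm ((f x)\<^sup>2 + (g x)\<^sup>2)" by simp
qed

lemma L2_real_add:
  assumes "f \<in> L2_real M" "g \<in> L2_real M"
  shows "(\<lambda>x. f x + g x) \<in> L2_real M"
  using assms L2_real_mult_integrable[OF assms]
  by (auto simp: L2_real_def power2_sum mult.assoc)

lemma L2_real_cmult: "f \<in> L2_real M \<Longrightarrow> (\<lambda>x. c * f x) \<in> L2_real M"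
  by (auto simp: L2_real_def power_mult_distrib)

lemma L2_real_diff:
  assumes "f \<in> L2_real M" "g \<in> L2_real M"
  shows "(\<lambda>x. f x - g x) \<in> L2_real M"
  using L2_real_add[OF assms(1) L2_real_cmult[OF assms(2), of "-1"]] by simp

lemma (in finite_measure) L2_real_const: "(\<lambda>_. c) \<in> L2_real M"
  by (simp add: L2_real_def)

lemma (in finite_measure) L2_real_integrable: "f \<in> L2_real M \<Longrightarrow> integrable M f"
  using L2_real_mult_integrable[OF _ L2_real_const[of 1]] by simp

lemma L2_real_bounded_by:
  assumes "f \<in> borel_measurable M" "g \<in> L2_real M" "\<And>x. x \<in> space M \<Longrightarrow> \<bar>f x\<bar> \<le> g x"
  shows "f \<in> L2_real M"
  unfolding L2_real_def
proof (safe)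
  show "integrable M (\<lambda>x. (f x)\<^sup>2)"
  proof (rule Bochner_Integration.integrable_bound)
    show "integrable M (\<lambda>x. (g x)\<^sup>2)" using assms(2) by (rule L2_realD)
    show "AE x in M. norm ((f x)\<^sup>2) \<le> norm ((g x)\<^sup>2)"
      using power_mono[OF assms(3), of _ 2] by (intro AE_I2) auto
  qed (use assms in auto)
qed (rule assms)

lemma continuous_on_L2_real:
  fixes f :: "'a::euclidean_space \<Rightarrow> real"
  assumes S: "compact S" and M: "finite_measure M" and sets: "sets M = sets (restrict_space borel S)"
    and f: "continuous_on S f"
  shows "f \<in> L2_real M"
proof -
  interpret finite_measure M by fact
  have space: "space M = S"
    using sets_eq_imp_space_eq[OF sets] by (simp add: space_restrict_space)
  have "f \<in> borel_measurable M"
    using borel_measurable_continuous_on_restrict[OF f] sets by (simp cong: measurable_cong_sets)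
  moreover have "bounded (f ` S)"
    using compact_continuous_image[OF f S] by (rule compact_imp_bounded)
  then obtain K where "\<And>x. x \<in> S \<Longrightarrow> \<bar>f x\<bar> \<le> K" by (auto simp: bounded_iff)
  ultimately show ?thesis
    by (intro L2_real_bounded_by[OF _ L2_real_const[of K]]) (auto simp: space)
qed

lemma continuous_L2_sphere:
  fixes f :: "'a::euclidean_space \<Rightarrow> real"
  assumes "continuous_on UNIV f"
  shows "f \<in> L2_real uniform_sphere"
proof -
  interpret prob_space "uniform_sphere :: 'a measure" by (rule prob_space_uniform_sphere)
  show ?thesis
    by (rule continuous_on_L2_real[OF compact_sphere finite_measure_axioms sets_uniform_sphere])
       (rule continuous_on_subset[OF assms subset_UNIV])
qed

lemma integral_square_add_le:
  assumes "f \<in> L2_real M" "g \<in> L2_real M"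
  shows "(LINT x|M. (f x + g x)\<^sup>2) \<le> 2 * (LINT x|M. (f x)\<^sup>2) + 2 * (LINT x|M. (g x)\<^sup>2)"
proof -
  have "(LINT x|M. (f x + g x)\<^sup>2) \<le> (LINT x|M. 2 * (f x)\<^sup>2 + 2 * (g x)\<^sup>2)"
  proof (rule integral_mono)
    show "(f x + g x)\<^sup>2 \<le> 2 * (f x)\<^sup>2 + 2 * (g x)\<^sup>2" for x
      using zero_le_power2[of "f x - g x"] by (simp add: power2_sum power2_diff)
  qed (use L2_real_add[OF assms, THEN L2_realD(2)] assms[THEN L2_realD(2)] in auto)
  also have "\<dots> = 2 * (LINT x|M. (f x)\<^sup>2) + 2 * (LINT x|M. (g x)\<^sup>2)"
    using assms by (subst Bochner_Integration.integral_add) (auto dest: L2_realD)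
  finally show ?thesis .
qed

section \<open>Closure of a linear space of functions in L2\<close>

definition L2_closure :: "'a measure \<Rightarrow> ('a \<Rightarrow> real) set \<Rightarrow> ('a \<Rightarrow> real) set" where
  "L2_closure M P = {f \<in> L2_real M. \<forall>e>0. \<exists>p\<in>P. (LINT x|M. (f x - p x)\<^sup>2) < e}"

locale L2_subspace = finite_measure M for M :: "'a measure" +
  fixes P :: "('a \<Rightarrow> real) set"
  assumes sub: "P \<subseteq> L2_real M"
    and add: "p \<in> P \<Longrightarrow> q \<in> P \<Longrightarrow> (\<lambda>x. p x + q x) \<in> P"
    and cmult: "p \<in> P \<Longrightarrow> (\<lambda>x. c * p x) \<in> P"
begin

lemma closure_sub: "f \<in> L2_closure M P \<Longrightarrow> f \<in> L2_real M"
  by (simp add: L2_closure_def)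

lemma closure_superset: "p \<in> P \<Longrightarrow> p \<in> L2_closure M P"
  using sub by (auto simp: L2_closure_def intro!: bexI[of _ p])

lemma closure_limit:
  assumes f: "f \<in> L2_real M"
    and lim: "\<And>e. e > 0 \<Longrightarrow> \<exists>g\<in>L2_closure M P. (LINT x|M. (f x - g x)\<^sup>2) < e"
  shows "f \<in> L2_closure M P"
  unfolding L2_closure_def
proof (safe)
  fix e :: real assume "e > 0"
  \<comment> \<open>Both errors are doubled by \<open>integral_square_add_le\<close>, hence
    \<open>e / 4\<close> for each.\<close>
  then obtain g where g: "g \<in> L2_closure M P" "(LINT x|M. (f x - g x)\<^sup>2) < e / 4"
    using lim[of "e / 4"] by auto
  then obtain p where p: "p \<in> P" "(LINT x|M. (g x - p x)\<^sup>2) < e / 4"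
    using \<open>e > 0\<close> unfolding L2_closure_def by (auto dest!: spec[of _ "e / 4"])
  have "(LINT x|M. ((f x - g x) + (g x - p x))\<^sup>2) \<le>
      2 * (LINT x|M. (f x - g x)\<^sup>2) + 2 * (LINT x|M. (g x - p x)\<^sup>2)"
    using f closure_sub[OF g(1)] p(1) sub by (intro integral_square_add_le L2_real_diff) auto
  also have "\<dots> < e" using g p by simp
  finally show "\<exists>p\<in>P. (LINT x|M. (f x - p x)\<^sup>2) < e"
    using p(1) by auto
qed (rule f)

lemma closure_add:
  assumes f: "f \<in> L2_closure M P" and g: "g \<in> L2_closure M P"
  shows "(\<lambda>x. f x + g x) \<in> L2_closure M P"
  unfolding L2_closure_def
proof (safe)
  show "(\<lambda>x. f x + g x) \<in> L2_real M" using f g by (intro L2_real_add closure_sub)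
  fix e :: real assume "e > 0"
  obtain p q where p: "p \<in> P" "(LINT x|M. (f x - p x)\<^sup>2) < e / 4"
    and q: "q \<in> P" "(LINT x|M. (g x - q x)\<^sup>2) < e / 4"
    using \<open>e > 0\<close> f g unfolding L2_closure_def by (auto dest!: spec[of _ "e / 4"])
  have "(LINT x|M. ((f x - p x) + (g x - q x))\<^sup>2) \<le>
      2 * (LINT x|M. (f x - p x)\<^sup>2) + 2 * (LINT x|M. (g x - q x)\<^sup>2)"
    using closure_sub[OF f] closure_sub[OF g] p(1) q(1) sub
    by (intro integral_square_add_le L2_real_diff) auto
  also have "\<dots> < e" using p q by simp
  finally show "\<exists>p\<in>P. (LINT x|M. (f x + g x - p x)\<^sup>2) < e"
    by (intro bexI[OF _ add[OF p(1) q(1)]]) (simp add: algebra_simps)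
qed

lemma closure_cmult:
  assumes f: "f \<in> L2_closure M P"
  shows "(\<lambda>x. c * f x) \<in> L2_closure M P"
  unfolding L2_closure_def
proof (safe)
  show "(\<lambda>x. c * f x) \<in> L2_real M" using f by (intro L2_real_cmult closure_sub)
  fix e :: real assume "e > 0"
  \<comment> \<open>The summand 1 keeps the denominator positive when \<open>c = 0\<close>.\<close>
  then obtain p where p: "p \<in> P" "(LINT x|M. (f x - p x)\<^sup>2) < e / (c\<^sup>2 + 1)"
    using f unfolding L2_closure_def
    by (auto dest!: spec[of _ "e / (c\<^sup>2 + 1)"] simp: add_nonneg_pos)
  have "(LINT x|M. (c * f x - c * p x)\<^sup>2) = c\<^sup>2 * (LINT x|M. (f x - p x)\<^sup>2)"
    by (simp add: right_diff_distrib[symmetric] power_mult_distrib del: right_diff_distrib)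
  also have "\<dots> \<le> (c\<^sup>2 + 1) * (LINT x|M. (f x - p x)\<^sup>2)"
    by (intro mult_right_mono) auto
  also have "\<dots> < e"
    using p(2) by (simp add: pos_less_divide_eq add_nonneg_pos mult.commute)
  finally show "\<exists>p\<in>P. (LINT x|M. (c * f x - p x)\<^sup>2) < e"
    by (intro bexI[OF _ cmult[OF p(1)]])
qed

text \<open>Dominated convergence with the majorant \<open>4 * (w x)^2\<close> of the squared error.
  Power series, indicator functions and simple functions all enter the closure through it.\<close>

lemma closure_dominated:
  assumes s: "\<And>n. s n \<in> L2_closure M P"
    and f: "f \<in> borel_measurable M"
    and lim: "\<And>x. x \<in> space M \<Longrightarrow> (\<lambda>n. s n x) \<longlonglongrightarrow> f x"
    and w: "w \<in> L2_real M" and dom: "\<And>n x. x \<in> space M \<Longrightarrow> \<bar>s n x\<bar> \<le> w x"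
  shows "f \<in> L2_closure M P"
proof (rule closure_limit)
  have fw: "\<bar>f x\<bar> \<le> w x" if "x \<in> space M" for x
    using tendsto_rabs[OF lim[OF that]] by (rule Lim_bounded) (use dom that in auto)
  show fL2: "f \<in> L2_real M" using f w fw by (rule L2_real_bounded_by)
  have "(\<lambda>n. LINT x|M. (f x - s n x)\<^sup>2) \<longlonglongrightarrow> (LINT x|M. 0)"
  proof (rule integral_dominated_convergence)
    show "integrable M (\<lambda>x. 4 * (w x)\<^sup>2)" using w by (auto dest: L2_realD)
    show "AE x in M. (\<lambda>n. (f x - s n x)\<^sup>2) \<longlonglongrightarrow> 0"
    proof (rule AE_I2)
      fix x assume "x \<in> space M"
      have "(\<lambda>n. (f x - s n x)\<^sup>2) \<longlonglongrightarrow> (f x - f x)\<^sup>2"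
        by (intro tendsto_intros lim \<open>x \<in> space M\<close>)
      then show "(\<lambda>n. (f x - s n x)\<^sup>2) \<longlonglongrightarrow> 0" by simp
    qed
    show "AE x in M. norm ((f x - s n x)\<^sup>2) \<le> 4 * (w x)\<^sup>2" for n
    proof (rule AE_I2)
      fix x assume "x \<in> space M"
      then have "\<bar>f x - s n x\<bar> \<le> 2 * w x" using fw[of x] dom[of x n] by linarith
      then have "\<bar>f x - s n x\<bar>\<^sup>2 \<le> (2 * w x)\<^sup>2" by (rule power_mono) simp
      then show "norm ((f x - s n x)\<^sup>2) \<le> 4 * (w x)\<^sup>2" by (simp add: power_mult_distrib)
    qed
    show "(\<lambda>x. (f x - s n x)\<^sup>2) \<in> borel_measurable M" for n
      using f closure_sub[OF s, THEN L2_realD(1)] by measurable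
  qed auto
  then have lim0: "(\<lambda>n. LINT x|M. (f x - s n x)\<^sup>2) \<longlonglongrightarrow> 0" by simp
  fix e :: real assume "e > 0"
  then have "\<forall>\<^sub>F n in sequentially. (LINT x|M. (f x - s n x)\<^sup>2) < e"
    by (rule order_tendstoD(2)[OF lim0])
  then obtain n where "(LINT x|M. (f x - s n x)\<^sup>2) < e"
    by (auto simp: eventually_sequentially)
  then show "\<exists>g\<in>L2_closure M P. (LINT x|M. (f x - g x)\<^sup>2) < e"
    using s by blast
qed

lemma closure_cong:
  assumes "f \<in> L2_closure M P" "\<And>x. x \<in> space M \<Longrightarrow> f x = g x"
  shows "g \<in> L2_closure M P"
proof (rule closure_dominated[of "\<lambda>_. f"])
  show "g \<in> borel_measurable M"
    using closure_sub[OF assms(1), THEN L2_realD(1)] measurable_cong[of M f g] assms(2) by auto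
  show "(\<lambda>x. \<bar>f x\<bar>) \<in> L2_real M"
    using closure_sub[OF assms(1)] by (auto simp: L2_real_def)
qed (use assms in auto)

lemma closure_sum:
  assumes "P \<noteq> {}" "\<And>i. i \<in> I \<Longrightarrow> f i \<in> L2_closure M P"
  shows "(\<lambda>x. \<Sum>i\<in>I. f i x) \<in> L2_closure M P"
proof -
  obtain p where "p \<in> P" using assms(1) by auto
  then have 0: "(\<lambda>x. 0) \<in> L2_closure M P"
    using closure_superset[OF cmult[of p 0]] by simp
  show ?thesis using assms(2)
    by (induction I rule: infinite_finite_induct) (auto simp: 0 intro: closure_add)
qed

text \<open>A square-integrable function is a pointwise limit of simple functions bounded by
  \<open>2 * \<bar>f\<bar>\<close>, and these are finite combinations of indicators.\<close>

lemma closure_eq_L2_real: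
  assumes "P \<noteq> {}" and ind: "\<And>A. A \<in> sets M \<Longrightarrow> indicator A \<in> L2_closure M P"
    and f: "f \<in> L2_real M"
  shows "f \<in> L2_closure M P"
proof -
  obtain s where s: "\<And>i. simple_function M (s i)" "\<And>x. x \<in> space M \<Longrightarrow> (\<lambda>i. s i x) \<longlonglongrightarrow> f x"
    "\<And>i x. x \<in> space M \<Longrightarrow> \<bar>s i x\<bar> \<le> 2 * \<bar>f x\<bar>"
    using borel_measurable_implies_sequence_metric[OF L2_realD(1)[OF f], of 0]
    by (simp add: dist_real_def) metis
  have "s i \<in> L2_closure M P" for i
  proof (rule closure_cong)
    show "(\<lambda>x. \<Sum>y\<in>s i ` space M. y * indicator (s i -` {y} \<inter> space M) x) \<in> L2_closure M P"
      by (intro closure_sum assms(1) closure_cmult ind simple_functionD(2)[OF s(1)])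
    show "(\<Sum>y\<in>s i ` space M. y * indicator (s i -` {y} \<inter> space M) x) = s i x"
      if "x \<in> space M" for x
    proof -
      have "(\<Sum>y\<in>s i ` space M. y * indicator (s i -` {y} \<inter> space M) x) =
            (\<Sum>y\<in>s i ` space M. if s i x = y then y else 0)"
        using that by (intro sum.cong) auto
      also have "\<dots> = s i x"
        using that simple_functionD(1)[OF s(1), of i] by (subst sum.delta') auto
      finally show ?thesis .
    qed
  qed
  then show ?thesis
  proof (rule closure_dominated[where w = "\<lambda>x. 2 * \<bar>f x\<bar>"])
    show "(\<lambda>x. 2 * \<bar>f x\<bar>) \<in> L2_real M"
      using f by (intro L2_real_cmult) (auto simp: L2_real_def)
  qed (use s L2_realD(1)[OF f] in auto)
qed

end

section \<open>Linear spans and density of powers of linear functionals\<close>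

text \<open>The span is generated by adding one multiple of a generator at a time, because bounding
  subspaces will later be enlarged in exactly this way.\<close>

inductive_set function_span :: "('i \<Rightarrow> 'a \<Rightarrow> real) \<Rightarrow> ('a \<Rightarrow> real) set" for g :: "'i \<Rightarrow> 'a \<Rightarrow> real" where
  zero: "(\<lambda>_. 0) \<in> function_span g"
| add_term: "p \<in> function_span g \<Longrightarrow> (\<lambda>x. p x + c * g i x) \<in> function_span g"

lemma function_span_base: "g i \<in> function_span g"
  using function_span.add_term[OF function_span.zero, of 1 g i] by simp

lemma function_span_add:
  assumes p: "p \<in> function_span g" and q: "q \<in> function_span g"
  shows "(\<lambda>x. p x + q x) \<in> function_span g"
  using q
proof induction
  case (add_term q c i)
  show ?case using function_span.add_term[OF add_term.IH, of c i] by (simp add: add.assoc)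
qed (simp add: p)

lemma function_span_cmult:
  assumes "p \<in> function_span g"
  shows "(\<lambda>x. c * p x) \<in> function_span g"
  using assms
proof induction
  case (add_term q b i)
  show ?case using function_span.add_term[OF add_term.IH, of "c * b" i]
    by (simp add: algebra_simps)
qed (simp add: function_span.zero)

lemma function_span_sum:
  "(\<And>k. k \<in> K \<Longrightarrow> p k \<in> function_span g) \<Longrightarrow> (\<lambda>x. \<Sum>k\<in>K. p k x) \<in> function_span g"
  by (induction K rule: infinite_finite_induct)
     (auto intro: function_span.zero function_span_add)

text \<open>By bilinearity, products of generators suffice.\<close>

lemma function_span_mult:
  assumes mult: "\<And>i k. (\<lambda>x. g i x * g k x) \<in> function_span g"
    and p: "p \<in> function_span g" and q: "q \<in> function_span g"
  shows "(\<lambda>x. p x * q x) \<in> function_span g"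
proof -
  have *: "(\<lambda>x. g i x * q x) \<in> function_span g" for i
    using q
  proof induction
    case (add_term q c k)
    show ?case
      using function_span_add[OF add_term.IH function_span_cmult[OF mult[of i k], of c]]
      by (simp add: algebra_simps)
  qed (simp add: function_span.zero)
  show ?thesis using p
  proof induction
    case (add_term p c i)
    show ?case
      using function_span_add[OF add_term.IH function_span_cmult[OF *[of i], of c]]
      by (simp add: algebra_simps)
  qed (simp add: function_span.zero)
qed

text \<open>
  The exponentials of linear functionals span an algebra, so the Stone-Weierstrass theorem applies
  to them directly; expanding them into power series leads to powers of linear functionals.
\<close>

abbreviation linear_powers :: "('a::euclidean_space \<Rightarrow> real) set" where
  "linear_powers \<equiv> function_span (\<lambda>(a, n) x. (a \<bullet> x) ^ n)"

theorem linear_powers_dense_L2: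
  fixes S :: "'a::euclidean_space set"
  assumes S: "compact S" and M: "finite_measure M" "sets M = sets (restrict_space borel S)"
    and f: "f \<in> L2_real M"
  shows "f \<in> L2_closure M linear_powers"
proof -
  interpret finite_measure M by fact
  have space: "space M = S"
    using sets_eq_imp_space_eq[OF M(2)] by (simp add: space_restrict_space)
  have contL2: "f \<in> L2_real M" if "continuous_on S f" for f :: "'a \<Rightarrow> real"
    using S M that by (rule continuous_on_L2_real)
  have cont_powers: "continuous_on S p" if "p \<in> linear_powers" for p
    using that by induction (auto intro!: continuous_intros)
  interpret L2_subspace M linear_powers
    by unfold_locales
       (use cont_powers contL2 in \<open>auto intro: function_span_add function_span_cmult\<close>)
  let ?C = "L2_closure M linear_powers"
  have ne: "linear_powers \<noteq> {}" using function_span.zero by blast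
  have exp: "(\<lambda>x. exp (a \<bullet> x)) \<in> ?C" for a
  proof (rule closure_dominated)
    let ?s = "\<lambda>N x. \<Sum>n<N. inverse (fact n) * (a \<bullet> x) ^ n"
    show "?s N \<in> ?C" for N
      using function_span_base[of "\<lambda>(a, n) x. (a \<bullet> x) ^ n" "(a, _)"]
      by (intro closure_superset function_span_sum function_span_cmult) simp
    show "(\<lambda>N. ?s N x) \<longlonglongrightarrow> exp (a \<bullet> x)" for x
      using exp_converges[of "a \<bullet> x"] by (simp add: sums_def)
    show "(\<lambda>x. exp \<bar>a \<bullet> x\<bar>) \<in> L2_real M" by (intro contL2 continuous_intros)
    show "\<bar>?s N x\<bar> \<le> exp \<bar>a \<bullet> x\<bar>" for N x
    proof -
      have "\<bar>?s N x\<bar> \<le> (\<Sum>n<N. inverse (fact n) * \<bar>a \<bullet> x\<bar> ^ n)"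
        by (rule order_trans[OF sum_abs]) (simp add: abs_mult power_abs)
      also have "\<dots> \<le> exp \<bar>a \<bullet> x\<bar>"
        using exp_converges[of "\<bar>a \<bullet> x\<bar>"] 
        by (intro sum_le_suminf[of "\<lambda>n. inverse (fact n) * \<bar>a \<bullet> x\<bar> ^ n" "{..<N}", THEN order_trans])
           (auto simp: sums_iff)
      finally show ?thesis .
    qed
    show "(\<lambda>x. exp (a \<bullet> x)) \<in> borel_measurable M"
      by (intro L2_realD(1) contL2 continuous_intros)
  qed
  let ?E = "function_span (\<lambda>a x. exp (a \<bullet> x)) :: ('a \<Rightarrow> real) set"
  have span_closure: "p \<in> ?C" if "p \<in> ?E" for p
    using that
  proof induction
    case zero
    show ?case by (intro closure_superset function_span.zero)
  next
    case (add_term p c a)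
    then show ?case by (intro closure_add closure_cmult exp)
  qed
  interpret E: function_ring_on ?E S
  proof
    show "continuous_on S p" if "p \<in> ?E" for p
      using that by induction (auto intro!: continuous_intros)
    show "(\<lambda>x. p x + q x) \<in> ?E" if "p \<in> ?E" "q \<in> ?E" for p q
      using that by (rule function_span_add)
    show "(\<lambda>x. p x * q x) \<in> ?E" if "p \<in> ?E" "q \<in> ?E" for p q
    proof (rule function_span_mult[OF _ that])
      show "(\<lambda>x. exp (a \<bullet> x) * exp (b \<bullet> x)) \<in> ?E" for a b
        using function_span_base[of "\<lambda>a x. exp (a \<bullet> x)" "a + b"]
        by (simp add: inner_add_left exp_add)
    qed
    show "(\<lambda>_. c) \<in> ?E" for c
      using function_span_cmult[OF function_span_base[of "\<lambda>a x. exp (a \<bullet> x)" 0], of c] by simp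
    \<comment> \<open>The functional given by \<open>x - y\<close> separates: its values at
      \<open>x\<close> and \<open>y\<close> differ by the squared norm of
      \<open>x - y\<close>.\<close>
    show "\<exists>p\<in>?E. p x \<noteq> p y" if "x \<noteq> y" for x y
    proof (intro bexI[OF _ function_span_base[of "\<lambda>a x. exp (a \<bullet> x)" "x - y"]])
      have "(x - y) \<bullet> (x - y) \<noteq> 0" using that by simp
      then show "exp ((x - y) \<bullet> x) \<noteq> exp ((x - y) \<bullet> y)" by (simp add: inner_diff_right)
    qed
  qed (rule S)
  have cont: "f \<in> ?C" if f: "continuous_on S f" for f
  proof (rule closure_limit)
    show "f \<in> L2_real M" using f by (rule contL2)
    fix e :: real assume "e > 0"
    let ?m = "measure M (space M)"
    \<comment> \<open>The total mass \<open>?m\<close> may be 0, hence the summand 1; the squared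
      error becomes at most \<open>e * (?m / (?m + 1))\<close>, which is below
      \<open>e\<close>.\<close>
    define \<delta> where "\<delta> = sqrt (e / (?m + 1))"
    have m: "0 < ?m + 1" by (simp add: add_nonneg_pos)
    then have \<delta>: "\<delta> > 0" "\<delta>\<^sup>2 = e / (?m + 1)" using \<open>e > 0\<close> by (auto simp: \<delta>_def)
    then obtain g where g: "g \<in> ?E" "\<And>x. x \<in> S \<Longrightarrow> \<bar>f x - g x\<bar> < \<delta>"
      using E.Stone_Weierstrass_basic[OF f] by blast
    have "(LINT x|M. (f x - g x)\<^sup>2) \<le> (LINT x|M. \<delta>\<^sup>2)"
    proof (rule integral_mono)
      show "integrable M (\<lambda>x. (f x - g x)\<^sup>2)"
        using L2_real_diff[OF contL2[OF f] closure_sub[OF span_closure[OF g(1)]]] by (rule L2_realD)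
      show "(f x - g x)\<^sup>2 \<le> \<delta>\<^sup>2" if "x \<in> space M" for x
        using power_mono[OF less_imp_le[OF g(2)], of x 2] that by (simp add: space)
    qed simp
    also have "\<dots> = e * (?m / (?m + 1))" by (simp add: \<delta>)
    also have "\<dots> < e * 1" using \<open>e > 0\<close> m by (intro mult_strict_left_mono) auto
    finally show "\<exists>g\<in>?C. (LINT x|M. (f x - g x)\<^sup>2) < e"
      using span_closure[OF g(1)] by auto
  qed
  have ind_meas: "(indicator A :: 'a \<Rightarrow> real) \<in> borel_measurable M" if "A \<in> sets borel" for A :: "'a set"
  proof -
    have "(indicator A :: 'a \<Rightarrow> real) \<in> borel_measurable (restrict_space borel S)"
      using that by (intro measurable_restrict_space1 borel_measurable_indicator)
    then show ?thesis using M(2) by (simp cong: measurable_cong_sets)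
  qed
  have closed: "indicator A \<in> ?C" if "closed A" for A :: "'a set"
  \<comment> \<open>By convention \<open>infdist x {}\<close> is 0, so the functions used for
    nonempty sets would tend to 1 here.\<close>
  proof (cases "A = {}")
    case True
    then show ?thesis by (intro closure_cong[OF cont[of "\<lambda>_. 0"]]) auto
  next
    case False
    show ?thesis
    proof (rule closure_dominated)
      \<comment> \<open>Continuous functions that are 1 on \<open>A\<close> and eventually 0 at
        every point outside, since \<open>A\<close> is closed.\<close>
      let ?s = "\<lambda>n x. max 0 (1 - real n * infdist x A)"
      show "?s n \<in> ?C" for n by (intro cont continuous_intros)
      show "(\<lambda>n. ?s n x) \<longlonglongrightarrow> indicator A x" for x
      proof (cases "x \<in> A")
        case True
        then show ?thesis by simp
      next
        case False
        then have pos: "infdist x A > 0"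
          using \<open>closed A\<close> \<open>A \<noteq> {}\<close> in_closed_iff_infdist_zero infdist_nonneg[of x A] by force
        obtain N where N: "real N * infdist x A > 1" using reals_Archimedean3[OF pos] by blast
        have "\<forall>n\<ge>N. ?s n x = 0"
        proof (intro allI impI)
          fix n assume "N \<le> n"
          then have "real N * infdist x A \<le> real n * infdist x A"
            using pos by (intro mult_right_mono) auto
          then show "?s n x = 0" using N by simp
        qed
        then have "(\<lambda>n. ?s n x) \<longlonglongrightarrow> 0"
          by (intro tendsto_eventually) (auto simp: eventually_sequentially)
        then show ?thesis using False by simp
      qed
      show "(\<lambda>_. 1) \<in> L2_real M" by (rule L2_real_const)
      show "\<bar>?s n x\<bar> \<le> 1" for n x by (simp add: infdist_nonneg)
      show "(indicator A :: 'a \<Rightarrow> real) \<in> borel_measurable M" using \<open>closed A\<close> by (intro ind_meas) simp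
    qed
  qed
  have borel: "indicator A \<in> ?C" if "A \<in> sets borel" for A :: "'a set"
  proof -
    \<comment> \<open>Closed sets form an intersection-stable generator; complements follow by
      linearity, disjoint unions by dominated convergence.\<close>
    have A: "A \<in> sigma_sets UNIV (Collect closed)" using that by (simp add: borel_eq_closed)
    show ?thesis
    proof (rule sigma_sets_induct_disjoint[where P = "\<lambda>A. indicator A \<in> ?C", OF _ _ A])
      show "Int_stable (Collect (closed :: 'a set \<Rightarrow> bool))" by (auto simp: Int_stable_def)
      show "Collect closed \<subseteq> Pow (UNIV :: 'a set)" by simp
      show "indicator {} \<in> ?C" by (rule closed) simp
      show "indicator A \<in> ?C" if "A \<in> Collect closed" for A :: "'a set"
        using that by (auto intro: closed)
    next
      fix A :: "'a set" assume "indicator A \<in> ?C"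
      then have "(\<lambda>x. 1 + (-1) * indicator A x) \<in> ?C"
        by (intro closure_add[OF cont[of "\<lambda>_. 1"]] closure_cmult) auto
      moreover have "(\<lambda>x. 1 + (-1) * indicator A x) = (indicator (UNIV - A) :: 'a \<Rightarrow> real)"
        by (auto simp: indicator_def)
      ultimately show "indicator (UNIV - A) \<in> ?C" by simp
    next
      fix A :: "nat \<Rightarrow> 'a set"
      assume A: "disjoint_family A" "range A \<subseteq> sigma_sets UNIV (Collect closed)"
        "\<And>i. indicator (A i) \<in> ?C"
      have ind: "(\<Sum>i<n. indicator (A i) x :: real) = indicator (\<Union>i<n. A i) x" for n x
        using A(1) by (intro indicator_UN_disjoint[symmetric]) (auto simp: disjoint_family_on_def)
      show "indicator (\<Union> (range A)) \<in> ?C"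
      proof (rule closure_dominated)
        show "(\<lambda>x. \<Sum>i<n. indicator (A i) x) \<in> ?C" for n
          by (intro closure_sum ne A)
        show "(\<lambda>n. \<Sum>i<n. indicator (A i) x) \<longlonglongrightarrow> (indicator (\<Union> (range A)) x :: real)" for x
          unfolding ind using LIMSEQ_indicator_UN[of A x] by simp
        show "\<bar>\<Sum>i<n. indicator (A i) x\<bar> \<le> (1::real)" for n x
          unfolding ind by (simp add: indicator_def)
        show "(\<lambda>_. 1) \<in> L2_real M" by (rule L2_real_const)
        show "(indicator (\<Union> (range A)) :: 'a \<Rightarrow> real) \<in> borel_measurable M"
          using A(2) by (intro ind_meas sets.countable_UN) (auto simp: borel_eq_closed)
      qed
    qed
  qed
  show ?thesis
  proof (rule closure_eq_L2_real[OF ne _ f])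
    fix A assume "A \<in> sets M"
    then have "A \<in> sets borel"
      using compact_imp_closed[OF S] by (simp add: M(2) sets_restrict_space_iff)
    then show "indicator A \<in> ?C" by (rule borel)
  qed
qed

section \<open>Bounding a pair of forms\<close>

text \<open>A single operation covers sums, multiples and, with \<open>t = -1\<close>, differences,
  so linearity of a form is one equation.\<close>

definition lincomb :: "('a \<Rightarrow> real) \<Rightarrow> real \<Rightarrow> ('a \<Rightarrow> real) \<Rightarrow> 'a \<Rightarrow> real" where
  "lincomb f t g = (\<lambda>x. f x + t * g x)"

lemma lincomb_L2: "f \<in> L2_real M \<Longrightarrow> g \<in> L2_real M \<Longrightarrow> lincomb f t g \<in> L2_real M"
  unfolding lincomb_def by (intro L2_real_add L2_real_cmult)

text \<open>
  A semidefinite form \<open>C\<close> and a symmetric form \<open>B\<close> on a space \<open>F\<close> of functions. A subspace \<open>W\<close> is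
  bounding if orthogonal projections with respect to \<open>C\<close> onto it exist, \<open>B\<close> is represented on it by
  an operator \<open>W \<rightarrow> W\<close>, and \<open>\<bar>B\<bar> \<le> \<kappa> * C\<close> holds on it. A generator on which the operator acts
  as a scalar of modulus at most \<open>\<kappa>\<close> modulo \<open>W\<close> may be adjoined: the residual of its projection
  to \<open>W\<close> is orthogonal to \<open>W\<close> for both forms.
\<close>

locale form_pair =
  fixes F :: "('a \<Rightarrow> real) set" and C B :: "('a \<Rightarrow> real) \<Rightarrow> ('a \<Rightarrow> real) \<Rightarrow> real" and \<kappa> :: real
  assumes F_zero: "(\<lambda>_. 0) \<in> F"
    and F_lincomb: "f \<in> F \<Longrightarrow> g \<in> F \<Longrightarrow> lincomb f t g \<in> F"
    and C_lincomb: "f \<in> F \<Longrightarrow> g \<in> F \<Longrightarrow> h \<in> F \<Longrightarrow> C (lincomb f t g) h = C f h + t * C g h"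
    and C_sym: "f \<in> F \<Longrightarrow> g \<in> F \<Longrightarrow> C f g = C g f"
    and C_nonneg: "f \<in> F \<Longrightarrow> C f f \<ge> 0"
    and B_lincomb: "f \<in> F \<Longrightarrow> g \<in> F \<Longrightarrow> h \<in> F \<Longrightarrow> B (lincomb f t g) h = B f h + t * B g h"
    and B_sym: "f \<in> F \<Longrightarrow> g \<in> F \<Longrightarrow> B f g = B g f"
begin

definition bounding :: "('a \<Rightarrow> real) set \<Rightarrow> bool" where
  "bounding W \<longleftrightarrow> W \<subseteq> F \<and> (\<lambda>_. 0) \<in> W \<and> (\<forall>f\<in>W. \<forall>g\<in>W. \<forall>t. lincomb f t g \<in> W) \<and>
     (\<forall>f\<in>F. \<exists>p\<in>W. \<forall>s\<in>W. C (lincomb f (-1) p) s = 0) \<and>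
     (\<forall>s\<in>W. \<exists>r\<in>W. \<forall>g\<in>F. B s g = C r g) \<and>
     (\<forall>s\<in>W. \<bar>B s s\<bar> \<le> \<kappa> * C s s)"

lemma zero_left: "g \<in> F \<Longrightarrow> C (\<lambda>_. 0) g = 0" "g \<in> F \<Longrightarrow> B (\<lambda>_. 0) g = 0"
  using C_lincomb[OF F_zero F_zero, of g 1] B_lincomb[OF F_zero F_zero, of g 1]
  by (auto simp: lincomb_def)

lemma C_lincomb_right: "f \<in> F \<Longrightarrow> g \<in> F \<Longrightarrow> h \<in> F \<Longrightarrow> C h (lincomb f t g) = C h f + t * C h g"
  by (simp add: C_sym[of h] F_lincomb C_lincomb)

lemma B_lincomb_right: "f \<in> F \<Longrightarrow> g \<in> F \<Longrightarrow> h \<in> F \<Longrightarrow> B h (lincomb f t g) = B h f + t * B h g"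
  by (simp add: B_sym[of h] F_lincomb B_lincomb)

text \<open>The degenerate case of Cauchy-Schwarz. It is needed because \<open>C\<close> is only
  semidefinite; the covariance, for instance, vanishes on constants.\<close>

lemma C_null:
  assumes "h \<in> F" "k \<in> F" "C h h = 0"
  shows "C k h = 0"
proof (rule ccontr)
  assume nz: "C k h \<noteq> 0"
  \<comment> \<open>Chosen so that the nonnegative quantity below would equal -1.\<close>
  define t where "t = - (C k k + 1) / (2 * C k h)"
  have "0 \<le> C (lincomb k t h) (lincomb k t h)"
    using assms by (intro C_nonneg F_lincomb)
  also have "\<dots> = C k k + 2 * t * C k h"
    using assms by (simp add: C_lincomb C_lincomb_right F_lincomb C_sym[of h k])
  also have "\<dots> = - 1" using nz by (simp add: t_def field_simps)
  finally show False by simp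
qed

lemma bounding_zero: "bounding {\<lambda>_. 0}"
  unfolding bounding_def
  by (auto simp: F_zero zero_left lincomb_def)
     (metis C_sym F_zero zero_left(1))+

lemma bounding_extend:
  assumes W: "bounding W" and f: "f \<in> F" and l: "\<bar>l\<bar> \<le> \<kappa>" and r: "r \<in> W"
    and rep: "\<And>g. g \<in> F \<Longrightarrow> B f g = l * C f g + C r g"
  shows "\<exists>W'. bounding W' \<and> W \<subseteq> W' \<and> f \<in> W'"
proof -
  have WF: "s \<in> F" if "s \<in> W" for s using W that by (auto simp: bounding_def)
  have W0: "(\<lambda>_. 0) \<in> W" using W by (simp add: bounding_def)
  have Wl: "lincomb s t w \<in> W" if "s \<in> W" "w \<in> W" for s t w using W that by (simp add: bounding_def)
  have Wp: "\<exists>p\<in>W. \<forall>s\<in>W. C (lincomb k (-1) p) s = 0" if "k \<in> F" for k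
    using W that by (simp add: bounding_def)
  have Wr: "\<exists>r\<in>W. \<forall>g\<in>F. B s g = C r g" if "s \<in> W" for s
    using W that by (simp add: bounding_def)
  have Wb: "\<bar>B s s\<bar> \<le> \<kappa> * C s s" if "s \<in> W" for s using W that by (simp add: bounding_def)
  obtain p where p: "p \<in> W" and orth: "\<And>s. s \<in> W \<Longrightarrow> C (lincomb f (-1) p) s = 0"
    using Wp[OF f] by auto
  define h where "h = lincomb f (-1) p"
  have h: "h \<in> F" unfolding h_def using f p WF by (intro F_lincomb) auto
  have Chs: "C h s = 0" if "s \<in> W" for s using orth that by (simp add: h_def)
  have Csh: "C s h = 0" if "s \<in> W" for s using Chs[OF that] C_sym[OF h WF[OF that]] by simp
  \<comment> \<open>Writing \<open>f = h + p\<close> moves the scalar \<open>l\<close> from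
    \<open>f\<close> to \<open>h\<close>; what is left over, namely \<open>r\<close>,
    \<open>l * p\<close> and the representative of \<open>B p\<close>, lies in
    \<open>W\<close>.\<close>
  have "\<exists>r'\<in>W. \<forall>g\<in>F. B h g = l * C h g + C r' g"
  proof -
    obtain p' where p': "p' \<in> W" "\<And>g. g \<in> F \<Longrightarrow> B p g = C p' g" using Wr[OF p] by auto
    have "B h g = l * C h g + C (lincomb (lincomb r l p) (-1) p') g" if "g \<in> F" for g
      using that f p p' r WF
      by (simp add: h_def B_lincomb C_lincomb F_lincomb rep algebra_simps)
    then show ?thesis using p p' r Wl by blast
  qed
  then obtain r' where r': "r' \<in> W" "\<And>g. g \<in> F \<Longrightarrow> B h g = l * C h g + C r' g" by auto
  \<comment> \<open>\<open>B s\<close> is represented by an element of \<open>W\<close>, to which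
    \<open>h\<close> is orthogonal. By symmetry this also removes the remainder \<open>r'\<close>: a
    form that is triangular and symmetric is diagonal.\<close>
  have Bsh: "B s h = 0" if "s \<in> W" for s
    using Wr[OF that] Csh h by auto
  have Bhs: "B h s = 0" if "s \<in> W" for s
    using Bsh[OF that] B_sym[OF h WF[OF that]] by simp
  have Bhh: "B h h = l * C h h" using r' h Csh by simp
  define W' where "W' = {lincomb s t h | s t. s \<in> W}"
  have W'I: "lincomb s t h \<in> W'" if "s \<in> W" for s t using that by (auto simp: W'_def)
  have "bounding W'"
    unfolding bounding_def
  proof (intro conjI ballI allI)
    show "W' \<subseteq> F" using WF h by (auto simp: W'_def intro: F_lincomb)
    show "(\<lambda>_. 0) \<in> W'" using W'I[OF W0, of 0] by (simp add: lincomb_def)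
  next
    fix f g t assume "f \<in> W'" "g \<in> W'"
    then obtain s a s' a' where *: "f = lincomb s a h" "g = lincomb s' a' h" "s \<in> W" "s' \<in> W"
      by (auto simp: W'_def)
    have "lincomb f t g = lincomb (lincomb s t s') (a + t * a') h"
      by (simp add: * lincomb_def algebra_simps)
    then show "lincomb f t g \<in> W'" using W'I Wl * by simp
  next
    fix k assume k: "k \<in> F"
    obtain q where q: "q \<in> W" "\<And>s. s \<in> W \<Longrightarrow> C (lincomb k (-1) q) s = 0" using Wp[OF k] by auto
    \<comment> \<open>If \<open>C h h = 0\<close>, division by zero makes \<open>c\<close> equal to
      0, and this is still right since \<open>C_null\<close> gives \<open>C k h = 0\<close>.\<close>
    define c where "c = C k h / C h h"
    have c: "c * C h h = C k h"
      using C_null[OF h k] by (cases "C h h = 0") (auto simp: c_def)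
    have q': "C k s = C q s" if "s \<in> W" for s
      using q(2)[OF that] C_lincomb[OF k WF[OF q(1)] WF[OF that], of "-1"] by simp
    have "C (lincomb k (-1) (lincomb q c h)) (lincomb s t h) = 0" if "s \<in> W" for s t
      using that k h q(1) WF c
      by (simp add: C_lincomb C_lincomb_right F_lincomb Csh Chs q')
    then show "\<exists>p\<in>W'. \<forall>s\<in>W'. C (lincomb k (-1) p) s = 0"
      by (intro bexI[OF _ W'I[OF q(1), of c]]) (auto simp: W'_def)
  next
    fix w assume "w \<in> W'"
    then obtain s t where w: "w = lincomb s t h" "s \<in> W" by (auto simp: W'_def)
    obtain s' where s': "s' \<in> W" "\<And>g. g \<in> F \<Longrightarrow> B s g = C s' g" using Wr[OF w(2)] by auto
    have "B w g = C (lincomb (lincomb s' t r') (t * l) h) g" if "g \<in> F" for g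
      using that w s' r' h WF by (simp add: B_lincomb C_lincomb F_lincomb algebra_simps)
    then show "\<exists>r\<in>W'. \<forall>g\<in>F. B w g = C r g" using W'I Wl s'(1) r'(1) by blast
    \<comment> \<open>The cross terms vanish for both forms, so the bound on \<open>W\<close> and
      the bound on \<open>h\<close> simply add up.\<close>
    have "\<bar>B w w\<bar> = \<bar>B s s + t\<^sup>2 * (l * C h h)\<bar>"
      using w h WF
      by (simp add: B_lincomb B_lincomb_right F_lincomb Bsh Bhs Bhh power2_eq_square mult.assoc)
    also have "\<dots> \<le> \<bar>B s s\<bar> + t\<^sup>2 * (\<bar>l\<bar> * C h h)"
      using abs_triangle_ineq[of "B s s" "t\<^sup>2 * (l * C h h)"] C_nonneg[OF h] by (simp add: abs_mult)
    also have "\<dots> \<le> \<kappa> * C s s + t\<^sup>2 * (\<kappa> * C h h)"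
      using Wb[OF w(2)] l C_nonneg[OF h] by (intro add_mono mult_left_mono mult_right_mono) auto
    also have "\<dots> = \<kappa> * C w w"
      using w h WF
      by (simp add: C_lincomb C_lincomb_right F_lincomb Csh Chs power2_eq_square algebra_simps)
    finally show "\<bar>B w w\<bar> \<le> \<kappa> * C w w" .
  qed
  moreover have "W \<subseteq> W'"
    using W'I[of _ 0] by (auto simp: lincomb_def)
  moreover have "f \<in> W'"
    using W'I[OF p, of 1] by (simp add: h_def lincomb_def)
  ultimately show ?thesis by blast
qed

end

section \<open>Unitary groups and Haar measure\<close>

lemma norm_vec_square: "(norm (x :: 'a::euclidean_space ^ 'n))\<^sup>2 = (\<Sum>k\<in>UNIV. (norm (x $ k))\<^sup>2)"
  by (simp add: power2_norm_eq_inner inner_vec_def)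

text \<open>The instances are the identity on the reals and \<open>cnj\<close> on the complex
  numbers, so both cases share one proof. As \<open>1 \<bullet> z\<close> is the real part of
  \<open>z\<close>, the last axiom says that the Euclidean inner product is the real part of the
  Hermitian one.\<close>

locale conj_field =
  fixes cj :: "'a::{real_normed_field,euclidean_space} \<Rightarrow> 'a"
  assumes cj_add: "cj (x + y) = cj x + cj y"
    and cj_mult: "cj (x * y) = cj x * cj y"
    and cj_cj [simp]: "cj (cj x) = x"
    and cj_self: "cj x * x = of_real ((norm x)\<^sup>2)"
    and inner_cj: "x \<bullet> y = 1 \<bullet> (cj x * y)"
begin

lemma cj_0 [simp]: "cj 0 = 0"
  using cj_add[of 0 0] by simp

lemma cj_of_real [simp]: "cj (of_real r) = of_real r"
  using cj_self[of "of_real r"] by (cases "r = 0") (auto simp: power2_eq_square)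

lemma cj_1 [simp]: "cj 1 = 1"
  using cj_of_real[of 1] by simp

lemma linear_cj: "linear cj"
  by (rule linearI) (auto simp: cj_add cj_mult scaleR_conv_of_real)

lemmas cj_diff = linear_diff[OF linear_cj]
lemmas cj_sum = linear_sum[OF linear_cj]

lemma continuous_on_cj [continuous_intros]: "continuous_on A f \<Longrightarrow> continuous_on A (\<lambda>x. cj (f x))"
  using linear_continuous_on[OF linear_conv_bounded_linear[THEN iffD1, OF linear_cj]]
  by (rule continuous_on_compose2[where g = cj]) auto

lemma norm_cj [simp]: "norm (cj x) = norm x"
  using arg_cong[OF cj_self[of x], of norm] by (cases "x = 0") (auto simp: norm_mult power2_eq_square)

definition hip :: "'a ^ 'n \<Rightarrow> 'a ^ 'n \<Rightarrow> 'a" where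
  "hip x y = (\<Sum>k\<in>UNIV. cj (x $ k) * y $ k)"

definition adj :: "'a ^ 'n ^ 'm \<Rightarrow> 'a ^ 'm ^ 'n" where
  "adj A = (\<chi> i j. cj (A $ j $ i))"

definition ugroup :: "('a ^ 'n ^ 'n) set" where
  "ugroup = {A. adj A ** A = mat 1 \<and> A ** adj A = mat 1}"

lemma inner_hip: "x \<bullet> y = 1 \<bullet> hip x y"
  unfolding hip_def inner_vec_def by (simp add: inner_sum_right inner_cj[symmetric])

lemma hip_self: "hip x x = of_real ((norm x)\<^sup>2)"
proof -
  have "hip x x = of_real (\<Sum>k\<in>UNIV. (norm (x $ k))\<^sup>2)"
    by (simp add: hip_def cj_self)
  then show ?thesis by (simp only: norm_vec_square)
qed

lemma hip_commute: "cj (hip x y) = hip y x"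
  by (simp add: hip_def cj_sum cj_mult mult.commute)

lemma hip_diff_right: "hip x (y - z) = hip x y - hip x z"
  and hip_smult_right: "hip x (c *s y) = c * hip x y"
  and hip_diff_left: "hip (x - w) y = hip x y - hip w y"
  by (simp_all add: hip_def sum.distrib sum_subtractf sum_distrib_left algebra_simps cj_diff)

lemma hip_scaleR_right: "hip x (r *\<^sub>R y) = r *\<^sub>R hip x y"
  and hip_scaleR_left: "hip (r *\<^sub>R x) y = r *\<^sub>R hip x y"
  by (simp_all add: hip_def scaleR_sum_right linear_scale[OF linear_cj])

lemma hip_axis [simp]: "hip (axis k 1) x = x $ k"
  by (simp add: hip_def axis_def if_distrib[where f = cj] if_distribR cong: if_cong)
     (simp add: if_distrib[where f = "\<lambda>c. c * _"] cong: if_cong)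

lemma norm_hip_axis_right [simp]: "norm (hip x (axis k 1)) = norm (x $ k)"
  by (metis hip_axis hip_commute norm_cj)

lemma continuous_on_hip [continuous_intros]:
  "continuous_on A f \<Longrightarrow> continuous_on A g \<Longrightarrow> continuous_on A (\<lambda>x. hip (f x) (g x))"
  unfolding hip_def by (intro continuous_intros)

lemma adj_adj [simp]: "adj (adj A) = A"
  by (simp add: adj_def vec_eq_iff)

lemma adj_mult: "adj (A ** B) = adj B ** adj A"
  by (simp add: adj_def matrix_matrix_mult_def vec_eq_iff cj_sum cj_mult mult.commute)

lemma hip_adj: "hip (A *v x) y = hip x (adj A *v y)"
proof -
  have "hip (A *v x) y = (\<Sum>k\<in>UNIV. \<Sum>l\<in>UNIV. cj (A $ k $ l) * cj (x $ l) * y $ k)"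
    by (simp add: hip_def matrix_vector_mult_def cj_sum cj_mult sum_distrib_right)
  also have "\<dots> = (\<Sum>l\<in>UNIV. \<Sum>k\<in>UNIV. cj (A $ k $ l) * cj (x $ l) * y $ k)"
    by (rule sum.swap)
  also have "\<dots> = hip x (adj A *v y)"
    by (simp add: hip_def matrix_vector_mult_def adj_def sum_distrib_left mult_ac)
  finally show ?thesis .
qed

lemma ugroupD: "A \<in> ugroup \<Longrightarrow> adj A ** A = mat 1" "A \<in> ugroup \<Longrightarrow> A ** adj A = mat 1"
  by (auto simp: ugroup_def)

lemma ugroup_mult:
  assumes A: "A \<in> ugroup" and B: "B \<in> ugroup"
  shows "A ** B \<in> ugroup"
proof -
  have "adj (A ** B) ** (A ** B) = adj B ** ((adj A ** A) ** B)"
    by (simp add: adj_mult matrix_mul_assoc)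
  moreover have "(A ** B) ** adj (A ** B) = A ** ((B ** adj B) ** adj A)"
    by (simp add: adj_mult matrix_mul_assoc)
  ultimately show ?thesis by (simp add: ugroupD[OF A] ugroupD[OF B] ugroup_def)
qed

lemma ugroup_adj: "A \<in> ugroup \<Longrightarrow> adj A \<in> ugroup"
  by (auto simp: ugroup_def)

lemma norm_ugroup: "A \<in> ugroup \<Longrightarrow> norm (A *v x) = norm x"
  using hip_adj[of A x "A *v x"] hip_self[of "A *v x"] hip_self[of x]
  by (simp add: matrix_vector_mul_assoc ugroupD del: of_real_power)

text \<open>
  For unit vectors \<open>u \<noteq> v\<close> and \<open>w = u - v\<close>, the unitary reflection \<open>x \<mapsto> x - (\<langle>w, x\<rangle> / \<langle>w, u\<rangle>) w\<close>
  maps \<open>u\<close> to \<open>v\<close>; it is unitary because \<open>2 * Re \<langle>w, u\<rangle> = norm w ^ 2\<close>.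
\<close>

lemma ugroup_transitive:
  fixes u v :: "'a ^ 'n"
  assumes u: "norm u = 1" and v: "norm v = 1"
  shows "\<exists>h\<in>ugroup. h *v u = v \<and> (\<forall>y. hip u y = 0 \<longrightarrow> hip v y = 0 \<longrightarrow> h *v y = y)"
proof (cases "u = v")
  case True
  have "mat 1 \<in> (ugroup :: ('a ^ 'n ^ 'n) set)"
    by (simp add: ugroup_def) (simp add: adj_def mat_def vec_eq_iff matrix_matrix_mult_def)
  then show ?thesis using True by (intro bexI[of _ "mat 1"]) auto
next
  case False
  define w where "w = u - v"
  define t where "t = hip w u"
  \<comment> \<open>The identity \<open>2 * Re <w, u> = norm w ^ 2\<close>, written without real
    parts.\<close>
  have t: "t + cj t = hip w w"
  proof -
    have "hip w w = hip w u - hip w v" by (simp add: w_def hip_diff_right)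
    moreover have "hip w v = - cj t"
      by (simp add: t_def hip_commute) (simp add: w_def hip_diff_left hip_diff_right hip_self u v)
    ultimately show ?thesis by (simp add: t_def)
  qed
  have "t \<noteq> 0"
  proof
    assume "t = 0"
    then have "hip w w = 0" using t by simp
    then show False using False by (simp add: hip_self w_def)
  qed
  then have ct: "cj t \<noteq> 0" by (metis cj_0 cj_cj)
  define h where "h = (\<chi> k l. (if k = l then 1 else 0) - w $ k * cj (w $ l) / t)"
  have hv: "h *v x = x - (hip w x / t) *s w" for x
  proof -
    have "(h *v x) $ k = x $ k - w $ k * hip w x / t" for k
    proof -
      have "(h *v x) $ k = (\<Sum>l\<in>UNIV. (if k = l then x $ l else 0) - w $ k / t * (cj (w $ l) * x $ l))"
        unfolding matrix_vector_mult_def h_def by (simp, intro sum.cong) (auto simp: algebra_simps)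
      also have "\<dots> = x $ k - w $ k * hip w x / t"
        by (simp add: sum_subtractf hip_def sum_distrib_left sum_divide_distrib)
      finally show ?thesis .
    qed
    then show ?thesis by (simp add: vec_eq_iff mult.commute)
  qed
  have ahv: "adj h *v x = x - (hip w x / cj t) *s w" for x
  proof -
    have "(adj h *v x) $ k = x $ k - w $ k * hip w x / cj t" for k
    proof -
      have cjd: "cj (a / t) = cj a / cj t" for a
        using cj_mult[of "a / t" t] \<open>t \<noteq> 0\<close> ct by (simp add: field_simps)
      have "(adj h *v x) $ k =
          (\<Sum>l\<in>UNIV. (if k = l then x $ l else 0) - w $ k / cj t * (cj (w $ l) * x $ l))"
        unfolding matrix_vector_mult_def h_def adj_def
        by (simp, intro sum.cong) (auto simp: algebra_simps cj_diff cj_mult cjd)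
      also have "\<dots> = x $ k - w $ k * hip w x / cj t"
        by (simp add: sum_subtractf hip_def sum_distrib_left sum_divide_distrib)
      finally show ?thesis .
    qed
    then show ?thesis by (simp add: vec_eq_iff mult.commute)
  qed
  \<comment> \<open>Since \<open>hip w w = t + cj t\<close>, the component along \<open>w\<close> is
    multiplied by \<open>- cj t / t\<close> under \<open>h\<close> and by the inverse factor
    \<open>- t / cj t\<close> under \<open>adj h\<close>.\<close>
  have "hip w (h *v x) = - (hip w x / t) * cj t" "hip w (adj h *v x) = - (hip w x / cj t) * t" for x
    using \<open>t \<noteq> 0\<close> ct
    by (simp_all add: hv ahv hip_diff_right hip_smult_right t[symmetric] distrib_left)
  then have "adj h *v (h *v x) = x" "h *v (adj h *v x) = x" for x
    using \<open>t \<noteq> 0\<close> ct by (simp_all add: ahv[of "h *v x"] hv[of "adj h *v x"]) (simp_all add: hv ahv vec_eq_iff)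
  then have "h \<in> ugroup"
    unfolding ugroup_def by (auto simp: matrix_vector_mul_assoc matrix_eq)
  moreover have "h *v u = v"
    using \<open>t \<noteq> 0\<close> by (simp add: hv t_def[symmetric]) (simp add: w_def)
  moreover have "h *v y = y" if "hip u y = 0" "hip v y = 0" for y
    using that by (simp add: hv w_def hip_diff_left)
  ultimately show ?thesis by blast
qed

lemma continuous_on_adj [continuous_intros]: "continuous_on A f \<Longrightarrow> continuous_on A (\<lambda>x. adj (f x))"
  unfolding adj_def by (intro continuous_intros)

lemma borel_measurable_matrix_mult:
  fixes f :: "'b \<Rightarrow> 'a ^ 'n ^ 'n"
  assumes "f \<in> borel_measurable M" "g \<in> borel_measurable M"
  shows "(\<lambda>x. f x ** g x) \<in> borel_measurable M"
  using assms unfolding matrix_matrix_mult_def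
  by (rule borel_measurable_continuous_Pair) (intro continuous_intros)

lemma borel_measurable_matrix_vector_mult:
  fixes f :: "'b \<Rightarrow> 'a ^ 'n ^ 'n"
  assumes "f \<in> borel_measurable M" "g \<in> borel_measurable M"
  shows "(\<lambda>x. f x *v g x) \<in> borel_measurable M"
  using assms unfolding matrix_vector_mult_def
  by (rule borel_measurable_continuous_Pair) (intro continuous_intros)

end

section \<open>Invariance properties of Haar measure\<close>

locale haar_group = conj_field cj for cj :: "'a::{real_normed_field,euclidean_space} \<Rightarrow> 'a" +
  fixes \<mu> :: "('a ^ 'n::finite ^ 'n) measure"
  assumes haar: "normalized_haar ugroup \<mu>"
begin

sublocale prob_space \<mu>
  using haar by (simp add: normalized_haar_def)

sublocale sphere: prob_space "uniform_sphere :: ('a ^ 'n) measure"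
  by (rule prob_space_uniform_sphere)

sublocale haar_pair: pair_prob_space \<mu> \<mu> ..

sublocale sphere_pair: pair_prob_space \<mu> "uniform_sphere :: ('a ^ 'n) measure" ..

lemma sets_haar [measurable_cong]: "sets \<mu> = sets (restrict_space borel ugroup)"
  using haar by (simp add: normalized_haar_def)

lemma space_haar [simp]: "space \<mu> = ugroup"
  using sets_eq_imp_space_eq[OF sets_haar] by (simp add: space_restrict_space)

lemma haar_borel: "(\<lambda>R. R) \<in> borel_measurable \<mu>"
  using measurable_restrict_space1[of "\<lambda>R. R" borel borel ugroup] by (simp cong: measurable_cong_sets add: sets_haar)

lemma sphere_borel: "(\<lambda>x. x) \<in> borel_measurable (uniform_sphere :: ('a ^ 'n) measure)"
  using measurable_restrict_space1[of "\<lambda>R. R" borel borel "sphere 0 1"]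
  by (simp cong: measurable_cong_sets add: sets_uniform_sphere)

lemma measurable_to_haar:
  "f \<in> borel_measurable N \<Longrightarrow> (\<And>x. x \<in> space N \<Longrightarrow> f x \<in> ugroup) \<Longrightarrow> f \<in> N \<rightarrow>\<^sub>M \<mu>"
  unfolding measurable_cong_sets[OF refl sets_haar] by (rule measurable_restrict_space2) auto

lemma measurable_to_sphere:
  fixes f :: "'b \<Rightarrow> 'a ^ 'n"
  shows "f \<in> borel_measurable N \<Longrightarrow> (\<And>x. x \<in> space N \<Longrightarrow> norm (f x) = 1) \<Longrightarrow> f \<in> N \<rightarrow>\<^sub>M uniform_sphere"
  unfolding measurable_cong_sets[OF refl sets_uniform_sphere] by (rule measurable_restrict_space2) auto

lemma measurable_haar_mult [measurable (raw)]:
  assumes "f \<in> N \<rightarrow>\<^sub>M \<mu>" "g \<in> N \<rightarrow>\<^sub>M \<mu>"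
  shows "(\<lambda>x. f x ** g x) \<in> N \<rightarrow>\<^sub>M \<mu>"
proof (rule measurable_to_haar)
  show "(\<lambda>x. f x ** g x) \<in> borel_measurable N"
    using assms[THEN measurable_compose[OF _ haar_borel]] by (rule borel_measurable_matrix_mult)
  show "f x ** g x \<in> ugroup" if "x \<in> space N" for x
    using measurable_space[OF assms(1) that] measurable_space[OF assms(2) that]
    by (simp add: ugroup_mult)
qed

lemma measurable_haar_adj [measurable (raw)]:
  assumes "f \<in> N \<rightarrow>\<^sub>M \<mu>"
  shows "(\<lambda>x. adj (f x)) \<in> N \<rightarrow>\<^sub>M \<mu>"
proof (rule measurable_to_haar)
  have "adj \<in> borel_measurable (borel :: ('a ^ 'n ^ 'n) measure)"
    by (intro borel_measurable_continuous_onI continuous_intros)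
  then show "(\<lambda>x. adj (f x)) \<in> borel_measurable N"
    using measurable_compose[OF assms haar_borel] by simp
  show "adj (f x) \<in> ugroup" if "x \<in> space N" for x
    using measurable_space[OF assms that] by (simp add: ugroup_adj)
qed

lemma measurable_haar_action [measurable (raw)]:
  assumes "f \<in> N \<rightarrow>\<^sub>M \<mu>" "g \<in> N \<rightarrow>\<^sub>M uniform_sphere"
  shows "(\<lambda>x. f x *v g x) \<in> N \<rightarrow>\<^sub>M uniform_sphere"
proof (rule measurable_to_sphere)
  show "(\<lambda>x. f x *v g x) \<in> borel_measurable N"
    using measurable_compose[OF assms(1) haar_borel] measurable_compose[OF assms(2) sphere_borel]
    by (rule borel_measurable_matrix_vector_mult)
  show "norm (f x *v g x) = 1" if "x \<in> space N" for x
    using measurable_space[OF assms(1) that] measurable_space[OF assms(2) that]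
    by (simp add: norm_ugroup)
qed

lemma measurable_haar_right: "h \<in> ugroup \<Longrightarrow> (\<lambda>R. R ** h) \<in> \<mu> \<rightarrow>\<^sub>M \<mu>"
  and measurable_haar_action_const:
    "norm e = 1 \<Longrightarrow> (\<lambda>R. R *v e) \<in> \<mu> \<rightarrow>\<^sub>M uniform_sphere"
  by (auto intro!: measurable_haar_mult measurable_haar_action)

text \<open>\<open>normalized_haar\<close> speaks of images of sets; the preimage under
  multiplication by \<open>g\<close> is the image under multiplication by
  \<open>adj g\<close>.\<close>

lemma distr_haar_left:
  assumes g: "g \<in> ugroup"
  shows "distr \<mu> \<mu> (\<lambda>R. g ** R) = \<mu>"
proof (rule measure_eqI)
  have [measurable]: "(\<lambda>_. g) \<in> \<mu> \<rightarrow>\<^sub>M \<mu>" using g by simp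
  fix A assume "A \<in> sets (distr \<mu> \<mu> (\<lambda>R. g ** R))"
  then have A: "A \<in> sets \<mu>" by simp
  then have "A \<subseteq> ugroup" using sets.sets_into_space by fastforce
  have "(\<lambda>R. g ** R) -` A \<inter> ugroup = (\<lambda>R. adj g ** R) ` A"
  proof (intro equalityI subsetI)
    fix R assume "R \<in> (\<lambda>R. g ** R) -` A \<inter> ugroup"
    then show "R \<in> (\<lambda>R. adj g ** R) ` A"
      using g by (intro image_eqI[of _ _ "g ** R"]) (auto simp: matrix_mul_assoc ugroupD)
  next
    fix R assume "R \<in> (\<lambda>R. adj g ** R) ` A"
    then obtain Q where "Q \<in> A" "R = adj g ** Q" by auto
    then show "R \<in> (\<lambda>R. g ** R) -` A \<inter> ugroup"
      using g \<open>A \<subseteq> ugroup\<close> by (auto simp: matrix_mul_assoc ugroupD ugroup_mult ugroup_adj)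
  qed
  then show "emeasure (distr \<mu> \<mu> (\<lambda>R. g ** R)) A = emeasure \<mu> A"
    using haar A ugroup_adj[OF g] by (simp add: emeasure_distr normalized_haar_def)
qed simp

lemma nn_integral_haar_left:
  assumes g: "g \<in> ugroup" and [measurable]: "f \<in> borel_measurable \<mu>"
  shows "(\<integral>\<^sup>+R. f (g ** R) \<partial>\<mu>) = (\<integral>\<^sup>+R. f R \<partial>\<mu>)"
proof -
  have [measurable]: "(\<lambda>_. g) \<in> \<mu> \<rightarrow>\<^sub>M \<mu>" using g by simp
  have "(\<integral>\<^sup>+R. f R \<partial>\<mu>) = (\<integral>\<^sup>+R. f R \<partial>distr \<mu> \<mu> (\<lambda>R. g ** R))"
    by (simp add: distr_haar_left[OF g])
  then show ?thesis by (simp add: nn_integral_distr)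
qed

text \<open>
  Unimodularity of a compact group: integrate \<open>f (x\<^sup>-\<^sup>1 y)\<close> over \<open>x\<close> and \<open>y\<close> in both orders.
\<close>

lemma distr_haar_adj: "distr \<mu> \<mu> adj = \<mu>"
proof (rule measure_eqI)
  fix A assume "A \<in> sets (distr \<mu> \<mu> adj)"
  then have [measurable]: "A \<in> sets \<mu>" by simp
  have "emeasure \<mu> A = (\<integral>\<^sup>+x. \<integral>\<^sup>+y. indicator A (adj x ** y) \<partial>\<mu> \<partial>\<mu>)"
  proof -
    have "(\<integral>\<^sup>+y. indicator A (adj x ** y) \<partial>\<mu>) = emeasure \<mu> A" if "x \<in> ugroup" for x
      using nn_integral_haar_left[OF ugroup_adj[OF that], of "indicator A"] by simp
    then have "(\<integral>\<^sup>+x. \<integral>\<^sup>+y. indicator A (adj x ** y) \<partial>\<mu> \<partial>\<mu>) = (\<integral>\<^sup>+x. emeasure \<mu> A \<partial>\<mu>)"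
      by (intro nn_integral_cong) simp
    then show ?thesis using emeasure_space_1 by simp
  qed
  also have "\<dots> = (\<integral>\<^sup>+y. \<integral>\<^sup>+x. indicator A (adj x ** y) \<partial>\<mu> \<partial>\<mu>)"
    by (rule haar_pair.Fubini') measurable
  also have "\<dots> = (\<integral>\<^sup>+y. emeasure (distr \<mu> \<mu> adj) A \<partial>\<mu>)"
  proof (intro nn_integral_cong)
    fix y assume "y \<in> space \<mu>"
    then have y: "adj y \<in> ugroup" by (simp add: ugroup_adj)
    have "(\<integral>\<^sup>+x. indicator A (adj x ** y) \<partial>\<mu>) = (\<integral>\<^sup>+x. indicator A (adj (adj y ** x)) \<partial>\<mu>)"
      by (simp add: adj_mult)
    also have "\<dots> = (\<integral>\<^sup>+x. indicator A (adj x) \<partial>\<mu>)"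
      by (rule nn_integral_haar_left[OF y]) measurable
    also have "\<dots> = (\<integral>\<^sup>+x. indicator A x \<partial>distr \<mu> \<mu> adj)"
      by (rule nn_integral_distr[symmetric]) measurable
    finally show "(\<integral>\<^sup>+x. indicator A (adj x ** y) \<partial>\<mu>) = emeasure (distr \<mu> \<mu> adj) A"
      by simp
  qed
  also have "\<dots> = emeasure (distr \<mu> \<mu> adj) A" using emeasure_space_1 by simp
  finally show "emeasure (distr \<mu> \<mu> adj) A = emeasure \<mu> A" ..
qed simp

text \<open>Inversion turns right multiplication by \<open>h\<close> into left multiplication by
  \<open>adj h\<close> and preserves the measure.\<close>

lemma distr_haar_right:
  assumes h: "h \<in> ugroup"
  shows "distr \<mu> \<mu> (\<lambda>R. R ** h) = \<mu>"
proof -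
  have [measurable]: "(\<lambda>_. adj h) \<in> \<mu> \<rightarrow>\<^sub>M \<mu>" using ugroup_adj[OF h] by simp
  have "\<mu> = distr (distr (distr \<mu> \<mu> adj) \<mu> (\<lambda>R. adj h ** R)) \<mu> adj"
    by (simp add: distr_haar_adj distr_haar_left ugroup_adj[OF h])
  also have "\<dots> = distr \<mu> \<mu> (\<lambda>R. R ** h)"
    by (subst distr_distr, measurable)+ (simp add: o_def adj_mult)
  finally show ?thesis ..
qed

lemma integral_haar_right:
  fixes f :: "'a ^ 'n ^ 'n \<Rightarrow> real"
  assumes h: "h \<in> ugroup" and f: "f \<in> borel_measurable \<mu>"
  shows "(LINT R|\<mu>. f (R ** h)) = (LINT R|\<mu>. f R)"
proof -
  have "(LINT R|\<mu>. f R) = (LINT R|distr \<mu> \<mu> (\<lambda>R. R ** h). f R)"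
    by (simp add: distr_haar_right[OF h])
  also have "\<dots> = (LINT R|\<mu>. f (R ** h))"
    by (rule integral_distr[OF measurable_haar_right[OF h] f])
  finally show ?thesis ..
qed

text \<open>Average \<open>indicator A (R *v x)\<close> over \<open>R\<close> and \<open>x\<close>.
  For fixed \<open>R\<close> the sphere measure is invariant under \<open>R\<close>; for fixed
  \<open>x = h *v e\<close>, right invariance replaces \<open>x\<close> by \<open>e\<close>. The two
  orders of integration yield the two measures.\<close>

lemma distr_haar_action:
  assumes e: "norm (e :: 'a ^ 'n) = 1"
  shows "distr \<mu> uniform_sphere (\<lambda>R. R *v e) = uniform_sphere"
proof (rule measure_eqI)
  let ?u = "uniform_sphere :: ('a ^ 'n) measure"
  note [measurable] = measurable_haar_action_const[OF e]
  fix A assume "A \<in> sets (distr \<mu> ?u (\<lambda>R. R *v e))"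
  then have [measurable]: "A \<in> sets ?u" by simp
  have "emeasure ?u A = (\<integral>\<^sup>+R. \<integral>\<^sup>+x. indicator A (R *v x) \<partial>?u \<partial>\<mu>)"
  proof -
    have "(\<integral>\<^sup>+x. indicator A (R *v x) \<partial>?u) = emeasure ?u A" if "R \<in> ugroup" for R
    proof -
      have [measurable]: "(\<lambda>_. R) \<in> ?u \<rightarrow>\<^sub>M \<mu>" using that by simp
      have "emeasure ?u A = emeasure (distr ?u ?u (\<lambda>x. R *v x)) A"
        using that by (subst distr_uniform_sphere_isometry) (auto simp: norm_ugroup)
      also have "\<dots> = (\<integral>\<^sup>+x. indicator A x \<partial>distr ?u ?u (\<lambda>x. R *v x))" by simp
      also have "\<dots> = (\<integral>\<^sup>+x. indicator A (R *v x) \<partial>?u)" by (rule nn_integral_distr) measurable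
      finally show ?thesis ..
    qed
    then have "(\<integral>\<^sup>+R. \<integral>\<^sup>+x. indicator A (R *v x) \<partial>?u \<partial>\<mu>) = (\<integral>\<^sup>+R. emeasure ?u A \<partial>\<mu>)"
      by (intro nn_integral_cong) simp
    then show ?thesis using emeasure_space_1 by simp
  qed
  also have "\<dots> = (\<integral>\<^sup>+x. \<integral>\<^sup>+R. indicator A (R *v x) \<partial>\<mu> \<partial>?u)"
    by (rule sphere_pair.Fubini'[symmetric]) measurable
  also have "\<dots> = (\<integral>\<^sup>+x. emeasure (distr \<mu> ?u (\<lambda>R. R *v e)) A \<partial>?u)"
  proof (intro nn_integral_cong)
    fix x assume "x \<in> space ?u"
    then obtain h where h: "h \<in> ugroup" "h *v e = x" using ugroup_transitive[OF e, of x] by auto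
    have "(\<integral>\<^sup>+R. indicator A (R *v x) \<partial>\<mu>) = (\<integral>\<^sup>+R. indicator A ((R ** h) *v e) \<partial>\<mu>)"
      by (simp add: h(2)[symmetric] matrix_vector_mul_assoc)
    also have "\<dots> = (\<integral>\<^sup>+R. indicator A (R *v e) \<partial>distr \<mu> \<mu> (\<lambda>R. R ** h))"
      by (rule nn_integral_distr[OF measurable_haar_right[OF h(1)], symmetric]) measurable
    also have "\<dots> = (\<integral>\<^sup>+R. indicator A (R *v e) \<partial>\<mu>)"
      by (simp add: distr_haar_right[OF h(1)])
    also have "\<dots> = (\<integral>\<^sup>+x. indicator A x \<partial>distr \<mu> ?u (\<lambda>R. R *v e))"
      by (rule nn_integral_distr[symmetric]) measurable
    finally show "(\<integral>\<^sup>+R. indicator A (R *v x) \<partial>\<mu>) = emeasure (distr \<mu> ?u (\<lambda>R. R *v e)) A"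
      by simp
  qed
  also have "\<dots> = emeasure (distr \<mu> ?u (\<lambda>R. R *v e)) A" using sphere.emeasure_space_1 by simp
  finally show "emeasure (distr \<mu> ?u (\<lambda>R. R *v e)) A = emeasure ?u A" ..
qed simp

end

section \<open>Conditional expectation given one basis vector\<close>

context conj_field
begin

lemma ugroup_hip: "A \<in> ugroup \<Longrightarrow> hip (A *v x) (A *v y) = hip x y"
  by (simp add: hip_adj matrix_vector_mul_assoc ugroupD)

text \<open>Two reflections: one takes \<open>u\<close> to \<open>u'\<close>; the second takes the
  image of \<open>v\<close> to \<open>v'\<close> and fixes \<open>u'\<close>, because both of these
  vectors are orthogonal to \<open>u'\<close>.\<close>

lemma ugroup_transitive_pairs:
  fixes u v :: "'a ^ 'n"
  assumes "norm u = 1" "norm v = 1" "hip u v = 0" "norm u' = 1" "norm v' = 1" "hip u' v' = 0"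
  shows "\<exists>h\<in>ugroup. h *v u = u' \<and> h *v v = v'"
proof -
  obtain g where g: "g \<in> ugroup" "g *v u = u'"
    using ugroup_transitive assms by blast
  have "hip u' (g *v v) = 0"
    using ugroup_hip[OF g(1), of u v] g(2) assms by simp
  then have 0: "hip (g *v v) u' = 0" "hip v' u' = 0"
    using hip_commute[of u' "g *v v"] hip_commute[of u' v'] assms by simp_all
  obtain h where h: "h \<in> ugroup" "h *v (g *v v) = v'" "h *v u' = u'"
    using ugroup_transitive[of "g *v v" v'] norm_ugroup[OF g(1), of v] assms 0 by auto
  then show ?thesis
    using g by (intro bexI[of _ "h ** g"]) (auto simp: matrix_vector_mul_assoc[symmetric] ugroup_mult)
qed

text \<open>The orthogonal projection onto the hyperplane orthogonal to
  \<open>axis j 1\<close>.\<close>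

definition erase :: "'n \<Rightarrow> 'a ^ 'n \<Rightarrow> 'a ^ 'n" where
  "erase j x = (\<chi> k. if k = j then 0 else x $ k)"

lemma hip_erase: "hip (erase j w) x = hip w (erase j x)"
  unfolding hip_def by (intro sum.cong) (auto simp: erase_def)

lemma norm_erase_sum: "(norm (erase j x))\<^sup>2 = (\<Sum>k\<in>UNIV - {j}. (norm (x $ k))\<^sup>2)"
proof -
  have "(norm (erase j x))\<^sup>2 = (\<Sum>k\<in>UNIV. if k = j then 0 else (norm (x $ k))\<^sup>2)"
    unfolding norm_vec_square by (intro sum.cong) (auto simp: erase_def)
  also have "\<dots> = (\<Sum>k\<in>UNIV - {j}. (norm (x $ k))\<^sup>2)"
    by (intro sum.mono_neutral_cong_right) auto
  finally show ?thesis .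
qed

lemma norm_erase: "(norm (erase j x))\<^sup>2 = (norm x)\<^sup>2 - (norm (x $ j))\<^sup>2"
  unfolding norm_erase_sum norm_vec_square[of x] by (simp add: sum_diff1)

text \<open>Pythagoras, after \<open>R\<close> is moved to the other side of the inner product. This
  is the origin of the factor \<open>\<bar>a\<bar>^2 - \<bar><a, y>\<bar>^2\<close> in the formula
  for \<open>T\<close>.\<close>

lemma norm_erase_adj:
  assumes "R \<in> ugroup"
  shows "(norm (erase j (adj R *v a)))\<^sup>2 = (norm a)\<^sup>2 - (norm (hip a (R *v axis j 1)))\<^sup>2"
proof -
  have "norm ((adj R *v a) $ j) = norm (hip (adj R *v a) (axis j 1))" by simp
  also have "\<dots> = norm (hip a (R *v axis j 1))" by (simp add: hip_adj)
  finally show ?thesis using norm_ugroup[OF ugroup_adj[OF assms], of a] by (simp add: norm_erase)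
qed

lemma continuous_on_erase [continuous_intros]:
  "continuous_on A f \<Longrightarrow> continuous_on A (\<lambda>x. erase j (f x))"
  unfolding erase_def
proof (intro continuous_on_vec_lambda)
  show "continuous_on A (\<lambda>x. if k = j then 0 else f x $ k)" if "continuous_on A f" for k
    using that by (cases "k = j") (auto intro!: continuous_intros)
qed

lemma norm_axis_1 [simp]: "norm (axis k 1 :: 'a ^ 'n) = 1"
proof -
  have "of_real ((norm (axis k 1 :: 'a ^ 'n))\<^sup>2) = (of_real 1 :: 'a)"
    unfolding hip_self[symmetric] by simp
  then show ?thesis by (simp only: of_real_eq_iff abs_square_eq_1 abs_norm_cancel)
qed

text \<open>Normalization with \<open>e\<close> as default direction for \<open>w = 0\<close>;
  assuming orthogonality to \<open>e\<close> as well makes the last clause true in that case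
  too.\<close>

lemma unit_direction:
  fixes w e :: "'a ^ 'n"
  assumes "norm e = 1"
  shows "\<exists>w'. norm w' = 1 \<and> w = norm w *\<^sub>R w' \<and> (\<forall>y. hip y w = 0 \<longrightarrow> hip y e = 0 \<longrightarrow> hip y w' = 0)"
proof (cases "w = 0")
  case True
  then show ?thesis using assms by auto
next
  case False
  then show ?thesis by (intro exI[of _ "w /\<^sub>R norm w"]) (auto simp: hip_scaleR_right)
qed

lemma integral_sphere_ugroup:
  fixes f :: "'a ^ 'n \<Rightarrow> real"
  assumes h: "h \<in> ugroup" and f: "f \<in> borel_measurable uniform_sphere"
  shows "(LINT x|uniform_sphere. f (h *v x)) = (LINT x|uniform_sphere. f x)"
proof -
  have "(\<lambda>x. h *v x) \<in> borel_measurable (borel :: ('a ^ 'n) measure)"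
    by (intro borel_measurable_continuous_onI matrix_vector_mult_linear_continuous_on)
  then have m: "(\<lambda>x. h *v x) \<in> (uniform_sphere :: ('a ^ 'n) measure) \<rightarrow>\<^sub>M uniform_sphere"
    unfolding measurable_cong_sets[OF sets_uniform_sphere sets_uniform_sphere]
    by (intro measurable_restrict_space2 measurable_restrict_space1)
       (auto simp: space_restrict_space norm_ugroup[OF h])
  have "(LINT x|uniform_sphere. f x) = (LINT x|distr uniform_sphere uniform_sphere (\<lambda>x. h *v x). f x)"
    using h by (subst distr_uniform_sphere_isometry) (auto simp: norm_ugroup)
  also have "\<dots> = (LINT x|uniform_sphere. f (h *v x))"
    by (rule integral_distr[OF m f])
  finally show ?thesis ..
qed

text \<open>By unitary invariance only the length of \<open>w\<close> matters, and homogeneity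
  extracts it. A general kernel \<open>k\<close> serves both the powers of the modulus and the
  powers of the real part.\<close>

lemma kernel_moment:
  fixes w e :: "'a ^ 'n" and k :: "'a \<Rightarrow> real"
  assumes k: "continuous_on UNIV k" and hom: "\<And>r s. r \<ge> 0 \<Longrightarrow> k (r *\<^sub>R s) = r ^ n * k s"
    and e: "norm e = 1"
  shows "(LINT x|uniform_sphere. k (hip w x)) = norm w ^ n * (LINT x|uniform_sphere. k (hip e x))"
proof -
  obtain w' where w': "norm w' = 1" "w = norm w *\<^sub>R w'" using unit_direction[OF e, of w] by auto
  obtain h where h: "h \<in> ugroup" "h *v e = w'" using ugroup_transitive[OF e w'(1)] by auto
  have "continuous_on UNIV (\<lambda>x. k (hip e x))"
    by (intro continuous_on_compose2[OF k] continuous_intros) auto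
  from L2_realD(1)[OF continuous_L2_sphere[OF this]]
  have m: "(\<lambda>x. k (hip e x)) \<in> borel_measurable uniform_sphere" .
  have "(LINT x|uniform_sphere. k (hip w x)) =
      (LINT x|uniform_sphere. norm w ^ n * k (hip e (adj h *v x)))"
    by (subst w'(2)) (simp add: hip_scaleR_left hom hip_adj[symmetric] h)
  also have "\<dots> = norm w ^ n * (LINT x|uniform_sphere. k (hip e x))"
    using integral_sphere_ugroup[OF ugroup_adj[OF h(1)] m] by simp
  finally show ?thesis .
qed

end

context haar_group
begin

lemma integral_haar_action:
  fixes f :: "'a ^ 'n \<Rightarrow> real"
  assumes e: "norm e = 1" and f: "f \<in> borel_measurable uniform_sphere"
  shows "(LINT R|\<mu>. f (R *v e)) = (LINT x|uniform_sphere. f x)"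
  using integral_distr[OF measurable_haar_action_const[OF e] f] distr_haar_action[OF e] by simp

lemma integrable_haar_action:
  fixes f :: "'a ^ 'n \<Rightarrow> real"
  assumes e: "norm e = 1" and f: "integrable uniform_sphere f"
  shows "integrable \<mu> (\<lambda>R. f (R *v e))"
  using integrable_distr[OF measurable_haar_action_const[OF e], of f] f distr_haar_action[OF e] by simp

lemma L2_haar_action:
  assumes e: "norm e = 1" and f: "f \<in> L2_real uniform_sphere"
  shows "(\<lambda>R. f (R *v e)) \<in> L2_real \<mu>"
  using integrable_haar_action[OF e L2_realD(2)[OF f]] L2_realD(1)[OF f]
    measurable_haar_action_const[OF e] by (auto simp: L2_real_def)

text \<open>Right invariance under an \<open>h\<close> that carries the second pair to the
  first.\<close>

lemma integral_haar_pair: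
  fixes f g :: "'a ^ 'n \<Rightarrow> real"
  assumes f: "f \<in> borel_measurable uniform_sphere" and g: "g \<in> borel_measurable uniform_sphere"
    and uv: "norm u = 1" "norm v = 1" "hip u v = 0" and uv': "norm u' = 1" "norm v' = 1" "hip u' v' = 0"
  shows "(LINT R|\<mu>. f (R *v u) * g (R *v v)) = (LINT R|\<mu>. f (R *v u') * g (R *v v'))"
proof -
  obtain h where h: "h \<in> ugroup" "h *v u' = u" "h *v v' = v"
    using ugroup_transitive_pairs[OF uv' uv] by auto
  have "(\<lambda>R. f (R *v u') * g (R *v v')) \<in> borel_measurable \<mu>"
    using measurable_compose[OF measurable_haar_action_const f, of u']
      measurable_compose[OF measurable_haar_action_const g, of v'] uv' by simp
  from integral_haar_right[OF h(1) this] show ?thesis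
    by (simp add: matrix_vector_mul_assoc[symmetric] h)
qed

text \<open>
  The conditional expectation of \<open>k (hip a b\<^sub>i)\<close> given \<open>b\<^sub>j\<close>. By invariance \<open>b\<^sub>i = R e\<^sub>i\<close> may be replaced
  by \<open>R v\<close> for any unit \<open>v\<close> orthogonal to \<open>e\<^sub>j\<close>; instead of normalizing, average over \<open>v = erase j x\<close>
  with \<open>x\<close> uniform on the sphere.
\<close>

lemma kernel_formula:
  fixes k :: "'a \<Rightarrow> real"
  assumes k: "continuous_on UNIV k" and hom: "\<And>r s. r \<ge> 0 \<Longrightarrow> k (r *\<^sub>R s) = r ^ n * k s"
    and g: "g \<in> L2_real uniform_sphere" and ij: "i \<noteq> j"
  shows "(LINT x|uniform_sphere. norm (erase j x) ^ n) *
           (LINT R|\<mu>. k (hip a (R *v axis i 1)) * g (R *v axis j 1))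
       = (LINT x|uniform_sphere. k (x $ j)) *
           (LINT R|\<mu>. norm (erase j (adj R *v a)) ^ n * g (R *v axis j 1))"
proof -
  let ?u = "uniform_sphere :: ('a ^ 'n) measure"
  have meas_k: "(\<lambda>x. k (hip a x)) \<in> borel_measurable borel" for a
    by (intro borel_measurable_continuous_onI continuous_on_compose2[OF k] continuous_intros) auto
  have meas_ku: "(\<lambda>x. k (hip a x)) \<in> borel_measurable ?u" for a
    unfolding measurable_cong_sets[OF sets_uniform_sphere refl]
    by (rule measurable_restrict_space1) (rule meas_k)
  have gm: "(\<lambda>R. g (R *v axis j 1)) \<in> borel_measurable \<mu>"
    by (rule L2_realD(1)[OF L2_haar_action[OF _ g]]) simp
  have gi: "integrable \<mu> (\<lambda>R. g (R *v axis j 1))"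
    by (rule L2_real_integrable[OF L2_haar_action[OF _ g]]) simp
  have shift: "(LINT R|\<mu>. k (hip a (R *v v)) * g (R *v axis j 1)) =
      norm v ^ n * (LINT R|\<mu>. k (hip a (R *v axis i 1)) * g (R *v axis j 1))"
    if v: "hip (axis j 1) v = 0" for v
  proof -
    have ax: "hip (axis j 1) (axis i 1) = 0" "hip (axis i 1) (axis j 1) = 0"
      using ij unfolding hip_axis by (simp_all add: axis_def)
    obtain v' where v': "norm v' = 1" "v = norm v *\<^sub>R v'" "hip (axis j 1) v' = 0"
      using unit_direction[OF norm_axis_1[of i], of v] v ax by blast
    have "hip v' (axis j 1) = 0" using v'(3) hip_commute[of "axis j 1" v'] by simp
    then have "(LINT R|\<mu>. k (hip a (R *v v')) * g (R *v axis j 1)) =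
        (LINT R|\<mu>. k (hip a (R *v axis i 1)) * g (R *v axis j 1))"
      using v' ax by (intro integral_haar_pair meas_ku L2_realD(1)[OF g]) auto
    moreover have "k (hip a (R *v v)) = norm v ^ n * k (hip a (R *v v'))" for R
      by (subst v'(2)) (simp add: linear_scale[OF matrix_vector_mul_linear] hip_scaleR_right hom)
    ultimately show ?thesis by (simp add: mult.assoc)
  qed
  have "compact ((\<lambda>x. k (hip a x)) ` cball 0 1)"
    by (intro compact_continuous_image continuous_on_compose2[OF k] continuous_intros) auto
  then have "bounded ((\<lambda>x. k (hip a x)) ` cball 0 1)" by (rule compact_imp_bounded)
  then obtain K where K: "\<And>x. norm x \<le> 1 \<Longrightarrow> \<bar>k (hip a x)\<bar> \<le> K"
    unfolding bounded_iff real_norm_def by (metis image_eqI mem_cball_0)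
  let ?f = "\<lambda>(R, x). k (hip a (R *v erase j x)) * g (R *v axis j 1)"
  \<comment> \<open>On the unit ball the kernel is bounded by \<open>K\<close>, so integrability of
    \<open>g\<close> is enough for Fubini.\<close>
  have "integrable (\<mu> \<Otimes>\<^sub>M ?u) ?f"
  proof (rule Bochner_Integration.integrable_bound)
    show "integrable (\<mu> \<Otimes>\<^sub>M ?u) (\<lambda>(R, x). K * \<bar>g (R *v axis j 1)\<bar>)"
    proof (rule sphere_pair.Fubini_integrable)
      show "(\<lambda>(R, x). K * \<bar>g (R *v axis j 1)\<bar>) \<in> borel_measurable (\<mu> \<Otimes>\<^sub>M ?u)"
        using measurable_compose[OF measurable_fst gm, of ?u] by (simp add: case_prod_beta')
      show "integrable \<mu> (\<lambda>R. LINT x|?u. norm (case (R, x) of (R, x) \<Rightarrow> K * \<bar>g (R *v axis j 1)\<bar>))"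
        using gi by (simp add: sphere.prob_space abs_mult)
    qed auto
    have "(\<lambda>p. fst p *v erase j (snd p)) \<in> borel_measurable (\<mu> \<Otimes>\<^sub>M ?u)"
    proof (rule borel_measurable_matrix_vector_mult)
      show "fst \<in> borel_measurable (\<mu> \<Otimes>\<^sub>M ?u)"
        using measurable_compose[OF measurable_fst[of \<mu> ?u] haar_borel] by simp
      have "erase j \<in> borel_measurable borel"
        by (intro borel_measurable_continuous_onI continuous_intros)
      then show "(\<lambda>p. erase j (snd p)) \<in> borel_measurable (\<mu> \<Otimes>\<^sub>M ?u)"
        using measurable_compose[OF measurable_compose[OF measurable_snd sphere_borel]] by blast
    qed
    then have "(\<lambda>p. k (hip a (fst p *v erase j (snd p)))) \<in> borel_measurable (\<mu> \<Otimes>\<^sub>M ?u)"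
      by (rule measurable_compose[OF _ meas_k])
    then show "?f \<in> borel_measurable (\<mu> \<Otimes>\<^sub>M ?u)"
      using measurable_compose[OF measurable_fst gm, of ?u] by (simp add: case_prod_beta')
    have "norm (erase j x) \<le> 1" if "norm x = 1" for x :: "'a ^ 'n"
      by (rule power2_le_imp_le) (simp_all add: norm_erase that)
    then show "AE p in \<mu> \<Otimes>\<^sub>M ?u. norm (?f p) \<le> norm (case p of (R, x) \<Rightarrow> K * \<bar>g (R *v axis j 1)\<bar>)"
      using K by (intro AE_I2)
        (auto simp: space_pair_measure abs_mult norm_ugroup intro!: mult_right_mono
          order_trans[OF K abs_ge_self])
  qed
  note Fubini = sphere_pair.Fubini_integral[OF this]
  have orth: "hip (axis j 1) (erase j x) = 0" for x :: "'a ^ 'n" by (simp add: erase_def)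
  \<comment> \<open>\<open>R\<close> and the self-adjoint projection move over to \<open>a\<close>;
    what remains is a moment of the vector \<open>erase j (adj R *v a)\<close>.\<close>
  have inner: "(LINT x|?u. k (hip a (R *v erase j x))) =
      norm (erase j (adj R *v a)) ^ n * (LINT x|?u. k (x $ j))" for R
  proof -
    have "hip a (R *v erase j x) = hip (erase j (adj R *v a)) x" for x
      by (simp add: hip_erase hip_adj)
    then show ?thesis
      using kernel_moment[OF k hom, of "axis j 1" "erase j (adj R *v a)"] by simp
  qed
  \<comment> \<open>Integration over \<open>R\<close> first uses \<open>shift\<close>, integration
    over \<open>x\<close> first uses \<open>inner\<close>.\<close>
  have "(LINT x|?u. norm (erase j x) ^ n) * (LINT R|\<mu>. k (hip a (R *v axis i 1)) * g (R *v axis j 1)) =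
      (LINT x|?u. LINT R|\<mu>. k (hip a (R *v erase j x)) * g (R *v axis j 1))"
    by (simp add: shift[OF orth])
  also have "\<dots> = (LINT R|\<mu>. LINT x|?u. k (hip a (R *v erase j x)) * g (R *v axis j 1))"
    using Fubini by simp
  also have "\<dots> = (LINT R|\<mu>. (LINT x|?u. k (x $ j)) *
      (norm (erase j (adj R *v a)) ^ n * g (R *v axis j 1)))"
    by (simp add: inner mult_ac)
  finally show ?thesis by simp
qed

end

section \<open>Elementary inequalities and passage to the limit\<close>

lemma sum_power_le_power_sum:
  fixes f :: "'i \<Rightarrow> real"
  assumes "finite A" "\<And>x. x \<in> A \<Longrightarrow> f x \<ge> 0"
  shows "(\<Sum>x\<in>A. f x ^ Suc n) \<le> (\<Sum>x\<in>A. f x) ^ Suc n"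
proof (induction n)
  case (Suc n)
  \<comment> \<open>One factor \<open>f x\<close> of each term is at most the whole sum.\<close>
  have "(\<Sum>x\<in>A. f x ^ Suc (Suc n)) \<le> (\<Sum>x\<in>A. f x ^ Suc n * (\<Sum>x\<in>A. f x))"
    using assms by (intro sum_mono) (auto intro!: mult_right_mono member_le_sum simp: mult.commute)
  also have "\<dots> = (\<Sum>x\<in>A. f x ^ Suc n) * (\<Sum>x\<in>A. f x)" by (simp add: sum_distrib_right)
  also have "\<dots> \<le> (\<Sum>x\<in>A. f x) ^ Suc n * (\<Sum>x\<in>A. f x)"
    using assms by (intro mult_right_mono Suc.IH sum_nonneg) auto
  finally show ?case by (simp add: mult.commute)
qed simp

text \<open>With the range written as \<open>..<Suc m\<close>, the top term
  \<open>(- 1) ^ m * t ^ (2 * m)\<close> splits off; it carries the diagonal entry of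
  \<open>T\<close>, the other terms are lower powers.\<close>

lemma power_diff_square_expand:
  fixes A t :: real
  shows "(A - t\<^sup>2) ^ m = (\<Sum>p<Suc m. real (m choose p) * (- 1) ^ p * A ^ (m - p) * t ^ (2 * p))"
proof -
  have "(A - t\<^sup>2) ^ m = (- t\<^sup>2 + A) ^ m" by simp
  also have "\<dots> = (\<Sum>p\<le>m. real (m choose p) * (- t\<^sup>2) ^ p * A ^ (m - p))"
    by (rule binomial_ring)
  also have "\<dots> = (\<Sum>p<Suc m. real (m choose p) * (- 1) ^ p * A ^ (m - p) * t ^ (2 * p))"
    unfolding lessThan_Suc_atMost
    by (intro sum.cong refl) (subst power_minus, simp add: power_mult)
  finally show ?thesis .
qed

lemma L2_Cauchy_Schwarz:
  assumes f: "f \<in> L2_real M" and g: "g \<in> L2_real M"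
  shows "\<bar>LINT x|M. f x * g x\<bar> \<le> sqrt (LINT x|M. (f x)\<^sup>2) * sqrt (LINT x|M. (g x)\<^sup>2)"
proof -
  define a b c where "a = (LINT x|M. (f x)\<^sup>2)" and "b = (LINT x|M. f x * g x)"
    and "c = (LINT x|M. (g x)\<^sup>2)"
  have int: "integrable M (\<lambda>x. (f x)\<^sup>2)" "integrable M (\<lambda>x. (g x)\<^sup>2)" "integrable M (\<lambda>x. f x * g x)"
    using f g by (auto intro: L2_realD L2_real_mult_integrable)
  have quad: "0 \<le> s\<^sup>2 * a + 2 * s * t * b + t\<^sup>2 * c" for s t
  proof -
    have "0 \<le> (LINT x|M. (s * f x + t * g x)\<^sup>2)" by simp
    also have "\<dots> = (LINT x|M. s\<^sup>2 * (f x)\<^sup>2 + 2 * s * t * (f x * g x) + t\<^sup>2 * (g x)\<^sup>2)"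
      by (intro Bochner_Integration.integral_cong) (auto simp: power2_sum power_mult_distrib)
    also have "\<dots> = s\<^sup>2 * a + 2 * s * t * b + t\<^sup>2 * c"
      using int by (simp add: a_def b_def c_def)
    finally show ?thesis .
  qed
  have ac: "0 \<le> a" "0 \<le> c" by (simp_all add: a_def c_def)
  have "b\<^sup>2 \<le> a * c"
  proof (cases "c = 0")
    case True
    have "b = 0"
    proof (rule ccontr)
      assume "b \<noteq> 0"
      \<comment> \<open>For \<open>c = 0\<close> these arguments make the quadratic equal to
        -1.\<close>
      then show False using quad[of 1 "- (a + 1) / (2 * b)"] True by (simp add: field_simps)
    qed
    then show ?thesis using ac by simp
  next
    case False
    have "0 \<le> c * (a * c - b\<^sup>2)"
      using quad[of c "- b"] by (simp add: power2_eq_square algebra_simps)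
    then show ?thesis using ac False by (simp add: zero_le_mult_iff)
  qed
  then have "sqrt (b\<^sup>2) \<le> sqrt (a * c)" by (rule real_sqrt_le_mono)
  then show ?thesis by (simp add: real_sqrt_mult a_def b_def c_def)
qed

context form_pair
begin

lemma bounding_sum:
  fixes f :: "nat \<Rightarrow> 'a \<Rightarrow> real"
  assumes W: "bounding W" and f: "\<And>p. p < n \<Longrightarrow> f p \<in> W"
  shows "(\<lambda>x. \<Sum>p<n. c p * f p x) \<in> W"
  using f
proof (induction n)
  case 0
  then show ?case using W by (simp add: bounding_def)
next
  case (Suc n)
  then have "lincomb (\<lambda>x. \<Sum>p<n. c p * f p x) (c n) (f n) \<in> W"
    using W by (auto simp: bounding_def)
  then show ?case by (simp add: lincomb_def)
qed

text \<open>Both sides of the inequality are continuous for any \<open>N\<close> that bounds the two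
  forms, as one sees by expanding them at \<open>p = \<phi> - d\<close> with \<open>N d\<close>
  tending to 0. The L2 norm will be used for \<open>N\<close>.\<close>

lemma bound_limit:
  assumes bd: "\<And>f g. f \<in> F \<Longrightarrow> g \<in> F \<Longrightarrow> \<bar>B f g\<bar> \<le> K * (N f * N g)"
      "\<And>f g. f \<in> F \<Longrightarrow> g \<in> F \<Longrightarrow> \<bar>C f g\<bar> \<le> K * (N f * N g)"
    and \<phi>: "\<phi> \<in> F"
    and approx: "\<And>e. e > 0 \<Longrightarrow> \<exists>p\<in>F. \<bar>N (lincomb \<phi> (-1) p)\<bar> < e \<and> \<bar>B p p\<bar> \<le> \<kappa> * C p p"
  shows "\<bar>B \<phi> \<phi>\<bar> \<le> \<kappa> * C \<phi> \<phi>"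
proof -
  have "\<exists>p\<in>F. \<bar>N (lincomb \<phi> (-1) p)\<bar> < inverse (real (Suc n)) \<and> \<bar>B p p\<bar> \<le> \<kappa> * C p p" for n
    by (rule approx) simp
  then obtain p where p: "\<And>n. p n \<in> F" "\<And>n. \<bar>N (lincomb \<phi> (-1) (p n))\<bar> < inverse (real (Suc n))"
    "\<And>n. \<bar>B (p n) (p n)\<bar> \<le> \<kappa> * C (p n) (p n)"
    by metis
  define d where "d n = lincomb \<phi> (-1) (p n)" for n
  have d: "d n \<in> F" for n unfolding d_def using \<phi> p by (intro F_lincomb)
  have pd: "p n = lincomb \<phi> (-1) (d n)" for n by (simp add: d_def lincomb_def)
  have Nd: "(\<lambda>n. N (d n)) \<longlonglongrightarrow> 0"
  proof (rule Lim_null_comparison[OF _ LIMSEQ_inverse_real_of_nat])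
    show "\<forall>\<^sub>F n in sequentially. norm (N (d n)) \<le> inverse (real (Suc n))"
      using p(2) by (auto simp: d_def intro!: always_eventually less_imp_le)
  qed
  have lim: "(\<lambda>n. D (p n) (p n)) \<longlonglongrightarrow> D \<phi> \<phi>"
    if bdD: "\<And>f g. f \<in> F \<Longrightarrow> g \<in> F \<Longrightarrow> \<bar>D f g\<bar> \<le> K * (N f * N g)"
      and Dl: "\<And>f g h t. f \<in> F \<Longrightarrow> g \<in> F \<Longrightarrow> h \<in> F \<Longrightarrow> D (lincomb f t g) h = D f h + t * D g h"
      and Dr: "\<And>f g h t. f \<in> F \<Longrightarrow> g \<in> F \<Longrightarrow> h \<in> F \<Longrightarrow> D h (lincomb f t g) = D h f + t * D h g"
    for D :: "('a \<Rightarrow> real) \<Rightarrow> ('a \<Rightarrow> real) \<Rightarrow> real"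
  proof -
    have 0: "(\<lambda>n. K * (x n * N (d n))) \<longlonglongrightarrow> 0" if "x \<longlonglongrightarrow> x0" for x x0
      using tendsto_mult[OF tendsto_const[of K] tendsto_mult[OF that Nd]] by simp
    have 1: "(\<lambda>n. D \<phi> (d n)) \<longlonglongrightarrow> 0"
      by (rule Lim_null_comparison[OF _ 0[OF tendsto_const[of "N \<phi>"]]])
         (simp add: bdD \<phi> d)
    have 2: "(\<lambda>n. D (d n) \<phi>) \<longlonglongrightarrow> 0"
      by (rule Lim_null_comparison[OF _ 0[OF tendsto_const[of "N \<phi>"]]])
         (use bdD[OF d \<phi>] in \<open>simp add: mult_ac\<close>)
    have 3: "(\<lambda>n. D (d n) (d n)) \<longlonglongrightarrow> 0"
      by (rule Lim_null_comparison[OF _ 0[OF Nd]]) (simp add: bdD d)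
    have "D (p n) (p n) = D \<phi> \<phi> - D \<phi> (d n) - D (d n) \<phi> + D (d n) (d n)" for n
      unfolding pd using \<phi> d by (simp add: Dl Dr F_lincomb)
    then show ?thesis
      using tendsto_add[OF tendsto_diff[OF tendsto_diff[OF tendsto_const[of "D \<phi> \<phi>"] 1] 2] 3]
      by simp
  qed
  show ?thesis
    using tendsto_rabs[OF lim[OF bd(1) B_lincomb B_lincomb_right]]
      tendsto_mult[OF tendsto_const[of \<kappa>] lim[OF bd(2) C_lincomb C_lincomb_right]]
    by (rule LIMSEQ_le) (use p(3) in auto)
qed

end

section \<open>Moments of coordinates on the sphere\<close>

context conj_field
begin

lemma coordinate_moment:
  "(LINT x|uniform_sphere. norm ((x :: 'a ^ 'n) $ k) ^ (2 * l)) =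
   (LINT x|uniform_sphere. norm ((x :: 'a ^ 'n) $ j) ^ (2 * l))"
  using kernel_moment[of "\<lambda>s. norm s ^ (2 * l)" "2 * l" "axis j 1" "axis k 1"]
  by (simp add: power_mult_distrib continuous_intros)

lemma integrable_sphere_continuous:
  fixes f :: "'a ^ 'n \<Rightarrow> real"
  assumes "continuous_on UNIV f"
  shows "integrable uniform_sphere f"
proof -
  interpret prob_space "uniform_sphere :: ('a ^ 'n) measure" by (rule prob_space_uniform_sphere)
  show ?thesis using continuous_L2_sphere[OF assms] by (rule L2_real_integrable)
qed

lemma sum_coordinate_moments:
  fixes j :: "'n::finite"
  shows "(LINT x|uniform_sphere. (\<Sum>k\<in>K. norm ((x :: 'a ^ 'n) $ k) ^ (2 * l))) =
    real (card K) * (LINT x|uniform_sphere. norm ((x :: 'a ^ 'n) $ j) ^ (2 * l))"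
proof -
  have "(LINT x|uniform_sphere. (\<Sum>k\<in>K. norm ((x :: 'a ^ 'n) $ k) ^ (2 * l))) =
      (\<Sum>k\<in>K. LINT x|uniform_sphere. norm ((x :: 'a ^ 'n) $ k) ^ (2 * l))"
    by (intro Bochner_Integration.integral_sum integrable_sphere_continuous continuous_intros)
  also have "\<dots> = (\<Sum>k\<in>K. LINT x|uniform_sphere. norm ((x :: 'a ^ 'n) $ j) ^ (2 * l))"
    by (intro sum.cong refl coordinate_moment)
  finally show ?thesis by simp
qed

text \<open>The \<open>d - 1\<close> coordinates other than \<open>j\<close> have equal moments, and
  the sum of their powers is at most the power of the sum of their squares. The constant
  \<open>1 / (d - 1)\<close> comes from here.\<close>

lemma erase_moment_ge:
  fixes j :: "'n::finite"
  shows "(real CARD('n) - 1) * (LINT x|uniform_sphere. norm ((x :: 'a ^ 'n) $ j) ^ (2 * Suc l))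
    \<le> (LINT x|uniform_sphere. norm (erase j (x :: 'a ^ 'n)) ^ (2 * Suc l))"
proof -
  have "(real CARD('n) - 1) * (LINT x|uniform_sphere. norm ((x :: 'a ^ 'n) $ j) ^ (2 * Suc l)) =
      (LINT x|uniform_sphere. (\<Sum>k\<in>UNIV - {j}. norm ((x :: 'a ^ 'n) $ k) ^ (2 * Suc l)))"
    unfolding sum_coordinate_moments[where j = j] by (simp add: card_Diff_singleton of_nat_diff Suc_leI)
  also have "\<dots> \<le> (LINT x|uniform_sphere. norm (erase j (x :: 'a ^ 'n)) ^ (2 * Suc l))"
  proof (intro integral_mono integrable_sphere_continuous continuous_intros)
    show "(\<Sum>k\<in>UNIV - {j}. norm (x $ k) ^ (2 * Suc l)) \<le> norm (erase j x) ^ (2 * Suc l)"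
      for x :: "'a ^ 'n"
      using sum_power_le_power_sum[of "UNIV - {j}" "\<lambda>k. (norm (x $ k))\<^sup>2" l]
      unfolding power_mult norm_erase_sum by simp
  qed
  finally show ?thesis .
qed

text \<open>For the exponent 2 the preceding estimate loses nothing, which is why quadratic
  functions attain the bound.\<close>

lemma erase_moment_2:
  fixes j :: "'n::finite"
  shows "(LINT x|uniform_sphere. (norm (erase j (x :: 'a ^ 'n)))\<^sup>2) =
    (real CARD('n) - 1) * (LINT x|uniform_sphere. (norm ((x :: 'a ^ 'n) $ j))\<^sup>2)"
  using sum_coordinate_moments[where K = "UNIV - {j}" and l = 1 and j = j]
  by (simp add: norm_erase_sum card_Diff_singleton of_nat_diff Suc_leI)

lemma coordinate_moment_2:
  fixes j :: "'n::finite"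
  shows "real CARD('n) * (LINT x|uniform_sphere. (norm ((x :: 'a ^ 'n) $ j))\<^sup>2) = 1"
proof -
  interpret prob_space "uniform_sphere :: ('a ^ 'n) measure" by (rule prob_space_uniform_sphere)
  have "real CARD('n) * (LINT x|uniform_sphere. (norm ((x :: 'a ^ 'n) $ j))\<^sup>2) =
      (LINT x|uniform_sphere. (\<Sum>k\<in>UNIV. (norm ((x :: 'a ^ 'n) $ k))\<^sup>2))"
    using sum_coordinate_moments[where K = UNIV and l = 1 and j = j] by simp
  also have "\<dots> = (LINT x|(uniform_sphere :: ('a ^ 'n) measure). 1)"
    by (intro Bochner_Integration.integral_cong) (auto simp: norm_vec_square[symmetric])
  finally show ?thesis using prob_space by simp
qed

text \<open>If it vanished, \<open>erase j x\<close> would be 0 almost everywhere, but its second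
  moment is \<open>(d - 1) / d\<close>.\<close>

lemma erase_moment_pos:
  fixes j :: "'n::finite"
  assumes "CARD('n) \<ge> 2"
  shows "(LINT x|uniform_sphere. norm (erase j (x :: 'a ^ 'n)) ^ (2 * Suc l)) > 0"
proof -
  have int: "integrable uniform_sphere (\<lambda>x :: 'a ^ 'n. norm (erase j x) ^ (2 * Suc l))" for l
    by (intro integrable_sphere_continuous continuous_intros)
  have "(LINT x|uniform_sphere. norm (erase j (x :: 'a ^ 'n)) ^ (2 * Suc l)) \<noteq> 0"
  proof
    assume "(LINT x|uniform_sphere. norm (erase j (x :: 'a ^ 'n)) ^ (2 * Suc l)) = 0"
    then have "AE x in uniform_sphere. norm (erase j (x :: 'a ^ 'n)) ^ (2 * Suc l) = 0"
      using integral_nonneg_eq_0_iff_AE[OF int] by simp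
    then have "AE x in uniform_sphere. (norm (erase j (x :: 'a ^ 'n)))\<^sup>2 = 0"
      by eventually_elim auto
    then have "(LINT x|uniform_sphere. (norm (erase j (x :: 'a ^ 'n)))\<^sup>2) = 0"
      by (rule integral_eq_zero_AE)
    then show False using erase_moment_2[of j] coordinate_moment_2[of j] assms by auto
  qed
  moreover have "(LINT x|uniform_sphere. norm (erase j (x :: 'a ^ 'n)) ^ (2 * Suc l)) \<ge> 0"
    by (intro Bochner_Integration.integral_nonneg) simp
  ultimately show ?thesis by linarith
qed

end

section \<open>The covariance forms and their bound\<close>

locale haar_basis = haar_group cj \<mu>
  for cj :: "'a::{real_normed_field,euclidean_space} \<Rightarrow> 'a" and \<mu> :: "('a ^ 'n::finite ^ 'n) measure" +
  fixes i j :: 'n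
  assumes ij: "i \<noteq> j"
begin

abbreviation "usphere \<equiv> uniform_sphere :: ('a ^ 'n) measure"

definition pairing :: "('a ^ 'n \<Rightarrow> real) \<Rightarrow> ('a ^ 'n \<Rightarrow> real) \<Rightarrow> real" where
  "pairing f g = (LINT R|\<mu>. f (R *v axis i 1) * g (R *v axis j 1))"

definition sphere_cov :: "('a ^ 'n \<Rightarrow> real) \<Rightarrow> ('a ^ 'n \<Rightarrow> real) \<Rightarrow> real" where
  "sphere_cov f g = (LINT x|usphere. f x * g x) - (LINT x|usphere. f x) * (LINT x|usphere. g x)"

text \<open>This is the form \<open>B\<close>, and \<open>sphere_cov\<close> is the form
  \<open>C\<close>. Subtracting the product of the means replaces the value 1 of \<open>T\<close> on
  constants by 0.\<close>

definition basis_cov :: "('a ^ 'n \<Rightarrow> real) \<Rightarrow> ('a ^ 'n \<Rightarrow> real) \<Rightarrow> real" where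
  "basis_cov f g = pairing f g - (LINT x|usphere. f x) * (LINT x|usphere. g x)"

lemma card_ge_2: "CARD('n) \<ge> 2"
  using card_mono[of UNIV "{i, j}"] ij by simp

lemma hip_ij: "hip (axis i 1 :: 'a ^ 'n) (axis j 1) = 0" "hip (axis j 1 :: 'a ^ 'n) (axis i 1) = 0"
  unfolding hip_axis using ij by (simp_all add: axis_def)

lemma pairing_integrable:
  "f \<in> L2_real usphere \<Longrightarrow> g \<in> L2_real usphere \<Longrightarrow>
    integrable \<mu> (\<lambda>R. f (R *v axis i 1) * g (R *v axis j 1))"
  by (intro L2_real_mult_integrable L2_haar_action) simp_all

text \<open>Self-adjointness of \<open>T\<close>: by invariance the orthonormal pair of fixed
  vectors may be exchanged.\<close>

lemma pairing_commute:
  assumes f: "f \<in> L2_real usphere" and g: "g \<in> L2_real usphere"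
  shows "pairing f g = pairing g f"
  unfolding pairing_def
  using integral_haar_pair[OF L2_realD(1)[OF f] L2_realD(1)[OF g], of "axis i 1" "axis j 1" "axis j 1" "axis i 1"]
  by (simp add: hip_ij del: hip_axis) (simp add: mult.commute)

lemma integral_lincomb:
  "f \<in> L2_real usphere \<Longrightarrow> g \<in> L2_real usphere \<Longrightarrow>
    (LINT x|usphere. lincomb f t g x) = (LINT x|usphere. f x) + t * (LINT x|usphere. g x)"
  unfolding lincomb_def
  by (subst Bochner_Integration.integral_add) (auto intro!: sphere.L2_real_integrable)

lemma sphere_cov_eq:
  assumes "f \<in> L2_real usphere"
  shows "sphere_cov f f = sphere.variance f"
  unfolding sphere_cov_def using assms
  by (subst sphere.variance_eq) (auto simp: power2_eq_square[symmetric] intro: L2_realD sphere.L2_real_integrable)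

lemma form_pair: "form_pair (L2_real usphere) sphere_cov basis_cov"
proof
  show "(\<lambda>_. 0) \<in> L2_real usphere" by (rule sphere.L2_real_const)
  fix f g :: "'a ^ 'n \<Rightarrow> real" and t :: real
  assume f: "f \<in> L2_real usphere" and g: "g \<in> L2_real usphere"
  show "lincomb f t g \<in> L2_real usphere" by (rule lincomb_L2[OF f g])
  show "sphere_cov f g = sphere_cov g f" by (simp add: sphere_cov_def mult.commute)
  show "basis_cov f g = basis_cov g f" by (simp add: basis_cov_def pairing_commute[OF f g])
  show "sphere_cov f f \<ge> 0" unfolding sphere_cov_eq[OF f] by (rule sphere.variance_positive)
  fix h assume h: "h \<in> L2_real usphere"
  have "(LINT x|usphere. lincomb f t g x * h x) = (LINT x|usphere. f x * h x + t * (g x * h x))"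
    by (simp add: lincomb_def algebra_simps)
  also have "\<dots> = (LINT x|usphere. f x * h x) + t * (LINT x|usphere. g x * h x)"
    using f g h by (subst Bochner_Integration.integral_add) (auto intro!: L2_real_mult_integrable)
  finally show "sphere_cov (lincomb f t g) h = sphere_cov f h + t * sphere_cov g h"
    by (simp add: sphere_cov_def integral_lincomb[OF f g] algebra_simps)
  have "pairing (lincomb f t g) h = (LINT R|\<mu>. f (R *v axis i 1) * h (R *v axis j 1)
      + t * (g (R *v axis i 1) * h (R *v axis j 1)))"
    by (simp add: pairing_def lincomb_def algebra_simps)
  also have "\<dots> = pairing f h + t * pairing g h"
    unfolding pairing_def using f g h
    by (subst Bochner_Integration.integral_add) (auto intro!: pairing_integrable)
  finally show "basis_cov (lincomb f t g) h = basis_cov f h + t * basis_cov g h"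
    by (simp add: basis_cov_def integral_lincomb[OF f g] algebra_simps)
qed

sublocale form_pair "L2_real usphere" sphere_cov basis_cov "1 / (real CARD('n) - 1)"
  by (rule form_pair)

lemma pairing_1: "g \<in> L2_real usphere \<Longrightarrow> pairing (\<lambda>_. 1) g = (LINT x|usphere. g x)"
  unfolding pairing_def using integral_haar_action[of "axis j 1" g] by (simp add: L2_realD)

text \<open>Testing against the constant 1 shows that \<open>f\<close> and its image
  \<open>h\<close> under \<open>T\<close> have the same mean, so representations survive
  centering.\<close>

lemma basis_cov_eq_sphere_cov:
  assumes f: "f \<in> L2_real usphere" and h: "h \<in> L2_real usphere"
    and rep: "\<And>g. g \<in> L2_real usphere \<Longrightarrow> pairing f g = (LINT x|usphere. h x * g x)"
    and g: "g \<in> L2_real usphere"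
  shows "basis_cov f g = sphere_cov h g"
proof -
  have "(LINT x|usphere. f x) = (LINT x|usphere. h x)"
    using rep[of "\<lambda>_. 1"] pairing_commute[OF f] pairing_1[OF f] sphere.L2_real_const[of 1] by simp
  then show ?thesis using rep[OF g] by (simp add: basis_cov_def sphere_cov_def)
qed

text \<open>The explicit form of \<open>T\<close> on kernels: \<open>kernel_formula\<close> divided
  by its positive moment and transported to the sphere.\<close>

lemma pairing_kernel:
  fixes k :: "'a \<Rightarrow> real"
  assumes k: "continuous_on UNIV k"
    and hom: "\<And>r s. r \<ge> 0 \<Longrightarrow> k (r *\<^sub>R s) = r ^ (2 * Suc l) * k s"
    and g: "g \<in> L2_real usphere"
  shows "pairing (\<lambda>x. k (hip a x)) g =
    (LINT x|usphere. (LINT x|usphere. k (x $ j)) / (LINT x|usphere. norm (erase j x) ^ (2 * Suc l))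
      * ((norm a)\<^sup>2 - (norm (hip a x))\<^sup>2) ^ Suc l * g x)"
proof -
  let ?q = "LINT x|usphere. norm (erase j x) ^ (2 * Suc l)"
  let ?m = "LINT x|usphere. k (x $ j)"
  let ?G = "\<lambda>x. ((norm a)\<^sup>2 - (norm (hip a x))\<^sup>2) ^ Suc l * g x"
  have "(\<lambda>x. ((norm a)\<^sup>2 - (norm (hip a x))\<^sup>2) ^ Suc l) \<in> L2_real usphere"
    by (intro continuous_L2_sphere continuous_intros)
  then have G: "?G \<in> borel_measurable usphere" using L2_realD(1)[OF g] by (auto dest: L2_realD)
  have "?q * pairing (\<lambda>x. k (hip a x)) g =
      ?m * (LINT R|\<mu>. norm (erase j (adj R *v a)) ^ (2 * Suc l) * g (R *v axis j 1))"
    unfolding pairing_def by (rule kernel_formula[OF k hom g ij])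
  also have "(LINT R|\<mu>. norm (erase j (adj R *v a)) ^ (2 * Suc l) * g (R *v axis j 1)) =
      (LINT R|\<mu>. ?G (R *v axis j 1))"
    unfolding power_mult by (intro Bochner_Integration.integral_cong) (auto simp: norm_erase_adj)
  also have "\<dots> = (LINT x|usphere. ?G x)"
    using integral_haar_action[OF _ G, of "axis j 1"] by simp
  finally have "pairing (\<lambda>x. k (hip a x)) g = ?m / ?q * (LINT x|usphere. ?G x)"
    using erase_moment_pos[OF card_ge_2, of j l] by (simp add: field_simps)
  then show ?thesis by (simp add: mult.assoc)
qed

text \<open>This is \<open>c_l\<close>. For uniform \<open>x\<close> the projection
  \<open>erase j x\<close> has uniform direction in the hyperplane, so the moment of a coordinate
  other than \<open>j\<close> is \<open>c_l\<close> times the moment of the length of the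
  projection; and all coordinates have the same moments.\<close>

definition ratio :: "nat \<Rightarrow> real" where
  "ratio l = (LINT x|usphere. norm (x $ j) ^ (2 * l)) / (LINT x|usphere. norm (erase j x) ^ (2 * l))"

lemma ratio_bounds: "0 \<le> ratio (Suc l)" "ratio (Suc l) \<le> 1 / (real CARD('n) - 1)"
proof -
  have "(LINT x|usphere. norm (x $ j) ^ (2 * Suc l)) \<ge> 0"
    by (intro Bochner_Integration.integral_nonneg) simp
  then show "0 \<le> ratio (Suc l)"
    using erase_moment_pos[OF card_ge_2, of j l] by (simp add: ratio_def)
  show "ratio (Suc l) \<le> 1 / (real CARD('n) - 1)"
    using erase_moment_pos[OF card_ge_2, of j l] erase_moment_ge[of j l] card_ge_2
    by (simp add: ratio_def field_simps)
qed

lemma ratio_1: "ratio 1 = 1 / (real CARD('n) - 1)"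
  using erase_moment_2[of j] coordinate_moment_2[of j] card_ge_2
  by (auto simp: ratio_def)

lemma basis_cov_modulus_power:
  assumes g: "g \<in> L2_real usphere"
  shows "basis_cov (\<lambda>x. norm (hip a x) ^ (2 * Suc l)) g =
    sphere_cov (\<lambda>x. ratio (Suc l) * ((norm a)\<^sup>2 - (norm (hip a x))\<^sup>2) ^ Suc l) g"
proof (rule basis_cov_eq_sphere_cov[OF _ _ _ g])
  show "pairing (\<lambda>x. norm (hip a x) ^ (2 * Suc l)) g =
      (LINT x|usphere. ratio (Suc l) * ((norm a)\<^sup>2 - (norm (hip a x))\<^sup>2) ^ Suc l * g x)"
    if "g \<in> L2_real usphere" for g
    unfolding ratio_def
    by (rule pairing_kernel[OF _ _ that, of "\<lambda>s. norm s ^ (2 * Suc l)"])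
       (auto intro!: continuous_intros simp: power_mult_distrib)
qed (intro continuous_L2_sphere continuous_intros)+

text \<open>Triangularity makes the induction work: the image of each power under \<open>T\<close>
  is a scalar multiple of it plus lower powers, which are already present. Constants start it, with
  scalar 0.\<close>

lemma bounding_modulus_powers:
  assumes "bounding W"
  shows "\<exists>W'. bounding W' \<and> W \<subseteq> W' \<and> (\<forall>l\<le>N. (\<lambda>x. norm (hip a x) ^ (2 * l)) \<in> W')"
proof (induction N)
  case 0
  have "basis_cov (\<lambda>_. 1) g = 0 * sphere_cov (\<lambda>_. 1) g + sphere_cov (\<lambda>_. 0) g"
    if "g \<in> L2_real usphere" for g
    using pairing_1[OF that] zero_left(1)[OF that] sphere.prob_space by (simp add: basis_cov_def)
  then show ?case
    using bounding_extend[OF assms sphere.L2_real_const[of 1], of 0 "\<lambda>_. 0"] assms card_ge_2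
    by (auto simp: bounding_def)
next
  case (Suc N)
  then obtain V where V: "bounding V" "W \<subseteq> V" "\<And>l. l \<le> N \<Longrightarrow> (\<lambda>x. norm (hip a x) ^ (2 * l)) \<in> V"
    by blast
  define f where "f = (\<lambda>x. norm (hip a x) ^ (2 * Suc N))"
  \<comment> \<open>\<open>c\<close> is the diagonal entry of \<open>T\<close>; the numbers
    \<open>b p\<close> are its entries at the lower powers.\<close>
  define c where "c = ratio (Suc N) * (- 1) ^ Suc N"
  define b where "b p = ratio (Suc N) * (real (Suc N choose p) * (- 1) ^ p * ((norm a)\<^sup>2) ^ (Suc N - p))" for p
  define r where "r = (\<lambda>x. \<Sum>p<Suc N. b p * norm (hip a x) ^ (2 * p))"
  have r: "r \<in> V" unfolding r_def using V by (intro bounding_sum) auto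
  have f: "f \<in> L2_real usphere" unfolding f_def by (intro continuous_L2_sphere continuous_intros)
  have "(\<lambda>x. ratio (Suc N) * ((norm a)\<^sup>2 - (norm (hip a x))\<^sup>2) ^ Suc N) = lincomb r c f"
    unfolding power_diff_square_expand lincomb_def r_def c_def b_def f_def
    by (simp add: fun_eq_iff distrib_left sum_distrib_left mult.assoc
        del: power_Suc binomial_Suc_Suc mult_Suc_right)
  then have "basis_cov f g = c * sphere_cov f g + sphere_cov r g" if "g \<in> L2_real usphere" for g
    using basis_cov_modulus_power[OF that, of a N] C_lincomb[OF _ f that, of r c] r V(1)
    by (auto simp: f_def bounding_def)
  moreover have "\<bar>c\<bar> \<le> 1 / (real CARD('n) - 1)"
    using ratio_bounds[of N] by (simp add: c_def abs_mult power_abs)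
  ultimately obtain W' where "bounding W'" "V \<subseteq> W'" "f \<in> W'"
    using bounding_extend[OF V(1) f _ r] by blast
  then show ?case using V by (intro exI[of _ W']) (auto simp: f_def le_Suc_eq)
qed

text \<open>Odd powers pair to 0 with everything. An even power is mapped by \<open>T\<close> into
  the span of the modulus powers in the same direction; these are adjoined beforehand, so the power
  itself enters with scalar 0.\<close>

lemma bounding_linear_power:
  assumes W: "bounding W"
  shows "\<exists>W'. bounding W' \<and> W \<subseteq> W' \<and> (\<lambda>x. (a \<bullet> x) ^ n) \<in> W'"
proof -
  have L2: "(\<lambda>x. (a \<bullet> x) ^ n) \<in> L2_real usphere"
    by (intro continuous_L2_sphere continuous_intros)
  have kap: "\<bar>0\<bar> \<le> 1 / (real CARD('n) - 1)" using card_ge_2 by simp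
  show ?thesis
  proof (cases "even n")
    case False
    let ?f = "\<lambda>x. (a \<bullet> x) ^ n"
    have "pairing ?f g = (LINT x|usphere. 0 * g x)" if g: "g \<in> L2_real usphere" for g
    proof -
      \<comment> \<open>\<open>- axis i 1\<close> is also a unit vector orthogonal to
        \<open>axis j 1\<close>.\<close>
      have "pairing ?f g = (LINT R|\<mu>. ?f (R *v (- axis i 1)) * g (R *v axis j 1))"
        unfolding pairing_def using hip_ij hip_scaleR_left[of "-1" "axis i 1" "axis j 1"]
        by (intro integral_haar_pair L2_realD(1)[OF L2] L2_realD(1)[OF g]) (auto simp del: hip_axis)
      also have "\<dots> = - pairing ?f g"
        using False by (simp add: pairing_def linear_neg[OF matrix_vector_mul_linear])
      finally show ?thesis by simp
    qed
    then have "basis_cov ?f g = 0 * sphere_cov ?f g + sphere_cov (\<lambda>_. 0) g"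
      if "g \<in> L2_real usphere" for g
      using basis_cov_eq_sphere_cov[OF L2 sphere.L2_real_const[of 0] _ that] by simp
    moreover have "(\<lambda>_. 0) \<in> W" using W by (simp add: bounding_def)
    ultimately show ?thesis using bounding_extend[OF W L2 kap] by blast
  next
    case True
    then obtain m where m: "n = 2 * m" by (elim evenE)
    obtain V where V: "bounding V" "W \<subseteq> V" "\<And>l. l \<le> m \<Longrightarrow> (\<lambda>x. norm (hip a x) ^ (2 * l)) \<in> V"
      using bounding_modulus_powers[OF W, of m a] by blast
    show ?thesis
    proof (cases m)
      case 0
      then show ?thesis using V(1,2) V(3)[of 0] m by (intro exI[of _ V]) auto
    next
      case (Suc l)
      \<comment> \<open>The power of the real part of the scalar \<open>s\<close>; by
        \<open>inner_hip\<close>, applying it to \<open>hip a x\<close> gives the power of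
        \<open>a \<bullet> x\<close>.\<close>
      let ?k = "\<lambda>s. (1 \<bullet> s) ^ (2 * Suc l) :: real"
      define c where "c = (LINT x|usphere. ?k (x $ j)) / (LINT x|usphere. norm (erase j x) ^ (2 * Suc l))"
      define r where "r = (\<lambda>x. c * ((norm a)\<^sup>2 - (norm (hip a x))\<^sup>2) ^ m)"
      define b where "b p = c * (real (m choose p) * (- 1) ^ p * ((norm a)\<^sup>2) ^ (m - p))" for p
      have r_sum: "r = (\<lambda>x. \<Sum>p<Suc m. b p * norm (hip a x) ^ (2 * p))"
        unfolding r_def power_diff_square_expand b_def sum_distrib_left by (simp only: mult.assoc)
      have r: "r \<in> V" unfolding r_sum using V by (intro bounding_sum) auto
      have rL2: "r \<in> L2_real usphere" unfolding r_def by (intro continuous_L2_sphere continuous_intros)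
      have "pairing (\<lambda>x. (a \<bullet> x) ^ n) g = (LINT x|usphere. r x * g x)" if "g \<in> L2_real usphere" for g
        using pairing_kernel[OF _ _ that, of ?k l a] m Suc
        by (simp add: r_def c_def inner_hip[symmetric] continuous_intros power_mult_distrib del: power_Suc mult_Suc_right)
      then have "basis_cov (\<lambda>x. (a \<bullet> x) ^ n) g = 0 * sphere_cov (\<lambda>x. (a \<bullet> x) ^ n) g + sphere_cov r g"
        if "g \<in> L2_real usphere" for g
        using basis_cov_eq_sphere_cov[OF L2 rL2 _ that] by simp
      then show ?thesis using bounding_extend[OF V(1) L2 kap r] V(2) by blast
    qed
  qed
qed

text \<open>The subspace may depend on \<open>p\<close>: it is enlarged once for each of the
  finitely many terms of \<open>p\<close>, and the bound is only wanted at \<open>p\<close>.\<close>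

lemma linear_powers_bounding:
  assumes "p \<in> (linear_powers :: ('a ^ 'n \<Rightarrow> real) set)"
  shows "\<exists>W. bounding W \<and> p \<in> W"
  using assms
proof induction
  case zero
  then show ?case using bounding_zero by blast
next
  case (add_term p c t)
  obtain W where W: "bounding W" "p \<in> W" using add_term.IH by blast
  obtain W' where W': "bounding W'" "W \<subseteq> W'" "(\<lambda>x. (fst t \<bullet> x) ^ snd t) \<in> W'"
    using bounding_linear_power[OF W(1)] by blast
  then have "lincomb p c (\<lambda>x. (fst t \<bullet> x) ^ snd t) \<in> W'"
    using W(2) by (auto simp: bounding_def)
  then show ?case using W'(1) by (auto simp: lincomb_def case_prod_beta')
qed

text \<open>The inequality holds on the dense set of linear powers and extends by continuity in L2.
  The constant \<open>K = 2\<close> counts two uses of Cauchy-Schwarz, one for the product and one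
  for the means.\<close>

theorem basis_cov_bound:
  assumes \<phi>: "\<phi> \<in> L2_real usphere"
  shows "\<bar>basis_cov \<phi> \<phi>\<bar> \<le> 1 / (real CARD('n) - 1) * sphere_cov \<phi> \<phi>"
proof (rule bound_limit[where N = "\<lambda>f. sqrt (LINT x|usphere. (f x)\<^sup>2)" and K = 2, OF _ _ \<phi>])
  let ?N = "\<lambda>f. sqrt (LINT x|usphere. (f x)\<^sup>2)"
  have mean: "\<bar>LINT x|usphere. f x\<bar> \<le> ?N f" if "f \<in> L2_real usphere" for f
    using L2_Cauchy_Schwarz[OF that sphere.L2_real_const[of 1]] sphere.prob_space by simp
  fix f g assume f: "f \<in> L2_real usphere" and g: "g \<in> L2_real usphere"
  have means: "\<bar>(LINT x|usphere. f x) * (LINT x|usphere. g x)\<bar> \<le> ?N f * ?N g"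
    unfolding abs_mult by (intro mult_mono mean f g) auto
  show "\<bar>sphere_cov f g\<bar> \<le> 2 * (?N f * ?N g)"
    unfolding sphere_cov_def using means L2_Cauchy_Schwarz[OF f g] by linarith
  \<comment> \<open>Each column of a Haar matrix is uniform, so the L2 norms on the sphere and over
    the group agree.\<close>
  have "?N h = sqrt (LINT R|\<mu>. (h (R *v axis k 1))\<^sup>2)" if "h \<in> L2_real usphere" for h k
    using integral_haar_action[of "axis k 1" "\<lambda>x. (h x)\<^sup>2"] L2_realD(2)[OF that] by simp
  then have "\<bar>pairing f g\<bar> \<le> ?N f * ?N g"
    unfolding pairing_def
    using L2_Cauchy_Schwarz[OF L2_haar_action[OF norm_axis_1 f] L2_haar_action[OF norm_axis_1 g]] f g
    by simp
  then show "\<bar>basis_cov f g\<bar> \<le> 2 * (?N f * ?N g)"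
    unfolding basis_cov_def using means by linarith
next
  fix e :: real assume "e > 0"
  have "\<phi> \<in> L2_closure usphere linear_powers"
    by (rule linear_powers_dense_L2[OF compact_sphere sphere.finite_measure_axioms sets_uniform_sphere \<phi>])
  then obtain p where p: "p \<in> linear_powers" "(LINT x|usphere. (\<phi> x - p x)\<^sup>2) < e\<^sup>2"
    using \<open>e > 0\<close> unfolding L2_closure_def by (auto dest!: spec[of _ "e\<^sup>2"])
  then have "sqrt (LINT x|usphere. (\<phi> x - p x)\<^sup>2) < e"
    using \<open>e > 0\<close> by (intro real_less_lsqrt) auto
  moreover obtain W where "bounding W" "p \<in> W" using linear_powers_bounding[OF p(1)] by blast
  ultimately show "\<exists>p\<in>L2_real usphere. \<bar>sqrt (LINT x|usphere. (lincomb \<phi> (-1) p x)\<^sup>2)\<bar> < e \<and>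
      \<bar>basis_cov p p\<bar> \<le> 1 / (real CARD('n) - 1) * sphere_cov p p"
    by (intro bexI[of _ p]) (auto simp: lincomb_def bounding_def)
qed

text \<open>For \<open>l = 1\<close> and \<open>a = axis j 1\<close>, \<open>T\<close> maps
  \<open>f\<close> to \<open>(1 - f) / (d - 1)\<close>, and the constant part has no covariance with
  \<open>f\<close>. The extremal covariance is thus negative.\<close>

lemma basis_cov_coordinate:
  "basis_cov (\<lambda>x. (norm (x $ j))\<^sup>2) (\<lambda>x. (norm (x $ j))\<^sup>2) =
    - (1 / (real CARD('n) - 1) * sphere_cov (\<lambda>x. (norm (x $ j))\<^sup>2) (\<lambda>x. (norm (x $ j))\<^sup>2))"
proof -
  let ?f = "\<lambda>x :: 'a ^ 'n. (norm (x $ j))\<^sup>2"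
  have f: "?f \<in> L2_real usphere" by (intro continuous_L2_sphere continuous_intros)
  have "basis_cov ?f ?f = sphere_cov (\<lambda>x. 1 / (real CARD('n) - 1) * (1 - ?f x)) ?f"
    using basis_cov_modulus_power[OF f, of "axis j 1" 0] ratio_1 by simp
  also have "(\<lambda>x. 1 / (real CARD('n) - 1) * (1 - ?f x)) =
      lincomb (\<lambda>_. 1 / (real CARD('n) - 1)) (- (1 / (real CARD('n) - 1))) ?f"
    by (simp add: lincomb_def fun_eq_iff right_diff_distrib)
  also have "sphere_cov \<dots> ?f = sphere_cov (\<lambda>_. 1 / (real CARD('n) - 1)) ?f
      - 1 / (real CARD('n) - 1) * sphere_cov ?f ?f"
    using C_lincomb[OF sphere.L2_real_const f f] by simp
  also have "sphere_cov (\<lambda>_. 1 / (real CARD('n) - 1)) ?f = 0"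
    using sphere.prob_space by (simp add: sphere_cov_def)
  finally show ?thesis by simp
qed

end

section \<open>Covariance of two basis vectors\<close>

text \<open>The part of the cone over \<open>U\<close> inside the open ball is open and contains
  half of \<open>x\<close>, so it has positive volume.\<close>

lemma emeasure_uniform_sphere_open:
  fixes U :: "'a::euclidean_space set"
  assumes U: "open U" "x \<in> U" "norm x = 1"
  shows "emeasure uniform_sphere (U \<inter> sphere 0 1) \<noteq> 0"
proof -
  have A: "U \<inter> sphere 0 1 \<in> sets (uniform_sphere :: 'a measure)"
    using U by (simp add: sets_uniform_sphere sets_restrict_space_iff)
  let ?V = "sgn -` U \<inter> (ball 0 1 - {0::'a})"
  have "continuous_on (ball 0 1 - {0::'a}) sgn"
    by (intro continuous_intros) auto
  then have V: "open ?V"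
    using U(1) by (subst Int_commute) (intro continuous_open_preimage, auto)
  have "(1/2) *\<^sub>R x \<in> ?V" using U by (auto simp: sgn_div_norm)
  then have "emeasure lborel ?V \<noteq> 0"
    using V by (intro emeasure_lborel_open_neq_0) auto
  moreover have sub: "?V \<subseteq> sgn -` (U \<inter> sphere 0 1) \<inter> (cball 0 1 - {0})"
    by (auto simp: norm_sgn)
  moreover have "sgn -` (U \<inter> sphere 0 1) \<inter> (cball 0 1 - {0}) \<in> sets borel"
  proof -
    have "sgn -` (U \<inter> sphere 0 1) \<inter> (cball 0 1 - {0})
        \<in> sets (restrict_space lborel (cball 0 1 - {0::'a}))"
      using measurable_sets[OF sgn_measurable_sphere, of "U \<inter> sphere 0 1"] A
      by (simp add: sets_uniform_sphere space_restrict_space)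
    then show ?thesis by (simp add: sets_restrict_space_iff)
  qed
  ultimately have "emeasure lborel (sgn -` (U \<inter> sphere 0 1) \<inter> (cball 0 1 - {0})) \<noteq> 0"
    using emeasure_mono[OF sub, of lborel] by auto
  \<comment> \<open>Infinite area would make the quotient 0 and contradict total mass 1.\<close>
  moreover have "emeasure (sphere_area :: 'a measure) (sphere 0 1) \<noteq> \<top>"
  proof
    assume "emeasure (sphere_area :: 'a measure) (sphere 0 1) = \<top>"
    moreover have "sphere 0 1 \<in> sets (uniform_sphere :: 'a measure)"
      using sets.top[of "uniform_sphere :: 'a measure"] by simp
    ultimately have "emeasure (uniform_sphere :: 'a measure) (sphere 0 1) = 0"
      by (simp add: emeasure_uniform_sphere)
    then show False
      using prob_space.emeasure_space_1[OF prob_space_uniform_sphere[where 'a = 'a]] by simp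
  qed
  ultimately show ?thesis
    by (simp add: emeasure_uniform_sphere[OF A] ennreal_divide_eq_0_iff)
qed

context conj_field
begin

text \<open>Zero variance would make the function almost everywhere equal to its mean. It is 1 at
  \<open>axis j 1\<close> and 0 at \<open>axis i 1\<close>, so the open regions above and below
  \<open>1/2\<close> both have positive measure, and the mean misses one of them.\<close>

lemma variance_coordinate_pos:
  fixes i j :: "'n::finite"
  assumes ij: "i \<noteq> j"
  shows "prob_space.variance uniform_sphere (\<lambda>x :: 'a ^ 'n. (norm (x $ j))\<^sup>2) > 0"
proof -
  let ?u = "uniform_sphere :: ('a ^ 'n) measure"
  let ?f = "\<lambda>x :: 'a ^ 'n. (norm (x $ j))\<^sup>2"
  interpret prob_space ?u by (rule prob_space_uniform_sphere)
  have "variance ?f \<noteq> 0"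
  proof
    assume "variance ?f = 0"
    moreover have "integrable ?u (\<lambda>x. (?f x - expectation ?f)\<^sup>2)"
      by (intro integrable_sphere_continuous continuous_intros)
    ultimately have AE: "AE x in ?u. (?f x - expectation ?f)\<^sup>2 = 0"
      by (subst (asm) integral_nonneg_eq_0_iff_AE) auto
    have null: "emeasure ?u (U \<inter> sphere 0 1) = 0"
      if "open U" "\<And>x. x \<in> U \<Longrightarrow> ?f x \<noteq> expectation ?f" for U
    proof -
      have A: "U \<inter> sphere 0 1 \<in> sets ?u"
        using that by (simp add: sets_uniform_sphere sets_restrict_space_iff)
      have "AE x in ?u. x \<notin> U \<inter> sphere 0 1"
        using AE by eventually_elim (use that(2) in auto)
      moreover have "{x \<in> space ?u. \<not> x \<notin> U \<inter> sphere 0 1} = U \<inter> sphere 0 1" by auto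
      ultimately show ?thesis using AE_iff_measurable[OF A, of "\<lambda>x. x \<notin> U \<inter> sphere 0 1"] by blast
    qed
    have ax: "axis j 1 $ j = (1::'a)" "axis i 1 $ j = (0::'a)" using ij by (simp_all add: axis_def)
    have op: "open {x. ?f x > 1/2}" "open {x. ?f x < 1/2}"
      by (intro open_Collect_less continuous_intros)+
    have pos: "emeasure ?u ({x. ?f x > 1/2} \<inter> sphere 0 1) \<noteq> 0"
        "emeasure ?u ({x. ?f x < 1/2} \<inter> sphere 0 1) \<noteq> 0"
      using emeasure_uniform_sphere_open[OF op(1), of "axis j 1"]
        emeasure_uniform_sphere_open[OF op(2), of "axis i 1"] ax by simp_all
    show False
    proof (cases "expectation ?f \<le> 1/2")
      case True
      then show False
        using pos(1) null[of "{x. ?f x > 1/2}"] op by force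
    next
      case False
      then show False
        using pos(2) null[of "{x. ?f x < 1/2}"] op by force
    qed
  qed
  then show ?thesis using variance_positive[of ?f] by linarith
qed

lemma onb_component_measurable:
  "(\<lambda>b. b $ k) \<in> onb_space (hip :: 'a ^ 'n \<Rightarrow> _) \<rightarrow>\<^sub>M uniform_sphere"
proof -
  have "norm (b $ k) = 1" if "b \<in> onb hip" for b :: "'a ^ 'n ^ 'n"
  proof -
    have "of_real ((norm (b $ k))\<^sup>2) = (of_real 1 :: 'a)"
      unfolding hip_self[symmetric] using that by (simp add: onb_def)
    then show ?thesis by (simp only: of_real_eq_iff abs_square_eq_1 abs_norm_cancel)
  qed
  moreover have "(\<lambda>b :: 'a ^ 'n ^ 'n. b $ k) \<in> borel_measurable borel"
    by (intro borel_measurable_continuous_onI continuous_intros)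
  ultimately show ?thesis
    unfolding onb_space_def measurable_cong_sets[OF refl sets_uniform_sphere]
    by (intro measurable_restrict_space2 measurable_restrict_space1) (auto simp: space_restrict_space)
qed

end

text \<open>Equality of laws transfers every integral to the Haar measure; both basis vectors are
  uniform on the sphere, so the two means agree and expanding the product leaves the centered
  pairing.\<close>

lemma (in haar_basis) covariance_uniform_onb:
  assumes M: "prob_space M" and b: "b \<in> M \<rightarrow>\<^sub>M onb_space hip"
    and law: "distr M (onb_space hip) b = distr \<mu> (onb_space hip) (\<lambda>R. \<chi> i. R *v axis i 1)"
    and \<phi>: "\<phi> \<in> L2_real usphere"
  shows "covariance M (\<lambda>\<omega>. \<phi> (b \<omega> $ i)) (\<lambda>\<omega>. \<phi> (b \<omega> $ j)) = basis_cov \<phi> \<phi>"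
proof -
  have cols: "(\<lambda>R. \<chi> i. R *v axis i 1) \<in> \<mu> \<rightarrow>\<^sub>M onb_space (hip :: 'a ^ 'n \<Rightarrow> _)"
    unfolding onb_space_def
  proof (rule measurable_restrict_space2)
    show "(\<lambda>R. \<chi> i. R *v axis i 1) \<in> space \<mu> \<rightarrow> onb (hip :: 'a ^ 'n \<Rightarrow> _)"
      by (auto simp: onb_def ugroup_hip) (simp_all add: axis_def)
    have "(\<lambda>R :: 'a ^ 'n ^ 'n. \<chi> i. R *v axis i 1) \<in> borel_measurable borel"
      unfolding matrix_vector_mult_def by (intro borel_measurable_continuous_onI continuous_intros)
    then show "(\<lambda>R. \<chi> i. R *v axis i 1) \<in> borel_measurable \<mu>"
      using measurable_compose[OF haar_borel] by blast
  qed
  have transfer: "(LINT \<omega>|M. F (b \<omega>)) = (LINT R|\<mu>. F (\<chi> i. R *v axis i 1))"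
    if F: "F \<in> borel_measurable (onb_space hip)" for F :: "'a ^ 'n ^ 'n \<Rightarrow> real"
    using integral_distr[OF b F] integral_distr[OF cols F] law by simp
  have comp: "(\<lambda>b. \<phi> (b $ k)) \<in> borel_measurable (onb_space hip)" for k
    by (rule measurable_compose[OF onb_component_measurable L2_realD(1)[OF \<phi>]])
  let ?m = "LINT x|usphere. \<phi> x"
  have mean: "(LINT \<omega>|M. \<phi> (b \<omega> $ k)) = ?m" for k
    using transfer[OF comp[of k]] integral_haar_action[OF _ L2_realD(1)[OF \<phi>], of "axis k 1"] by simp
  have "covariance M (\<lambda>\<omega>. \<phi> (b \<omega> $ i)) (\<lambda>\<omega>. \<phi> (b \<omega> $ j)) =
      (LINT \<omega>|M. (\<phi> (b \<omega> $ i) - ?m) * (\<phi> (b \<omega> $ j) - ?m))"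
    by (simp add: covariance_def mean)
  also have "\<dots> = (LINT R|\<mu>. (\<phi> (R *v axis i 1) - ?m) * (\<phi> (R *v axis j 1) - ?m))"
    using comp[of i] comp[of j]
    by (subst transfer[of "\<lambda>b. (\<phi> (b $ i) - ?m) * (\<phi> (b $ j) - ?m)"]) auto
  also have "\<dots> = (LINT R|\<mu>. \<phi> (R *v axis i 1) * \<phi> (R *v axis j 1) - ?m * \<phi> (R *v axis i 1)
      - ?m * \<phi> (R *v axis j 1) + ?m\<^sup>2)"
    by (simp add: algebra_simps power2_eq_square)
  also have "\<dots> = pairing \<phi> \<phi> - ?m * ?m"
    using integral_haar_action[OF _ L2_realD(1)[OF \<phi>]] prob_space
      integrable_haar_action[OF _ sphere.L2_real_integrable[OF \<phi>]] pairing_integrable[OF \<phi> \<phi>]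
    by (simp add: pairing_def power2_eq_square)
  finally show ?thesis by (simp add: basis_cov_def)
qed

lemma (in conj_field) uniform_onb_covariance:
  fixes i j :: "'n::finite"
  assumes ij: "i \<noteq> j" and b: "uniform_random_onb (hip :: 'a ^ 'n \<Rightarrow> _) ugroup M b"
  shows "\<phi> \<in> L2_real uniform_sphere \<Longrightarrow>
      \<bar>covariance M (\<lambda>\<omega>. \<phi> (b \<omega> $ i)) (\<lambda>\<omega>. \<phi> (b \<omega> $ j))\<bar>
        \<le> 1 / (real CARD('n) - 1) * prob_space.variance uniform_sphere \<phi>"
    and "\<bar>covariance M (\<lambda>\<omega>. (norm (b \<omega> $ i $ j))\<^sup>2) (\<lambda>\<omega>. (norm (b \<omega> $ j $ j))\<^sup>2)\<bar>
        = 1 / (real CARD('n) - 1) * prob_space.variance uniform_sphere (\<lambda>x :: 'a ^ 'n. (norm (x $ j))\<^sup>2)"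
proof -
  obtain \<mu> where \<mu>: "normalized_haar (ugroup :: ('a ^ 'n ^ 'n) set) \<mu>"
    and M: "prob_space M" "b \<in> M \<rightarrow>\<^sub>M onb_space hip"
      "distr M (onb_space hip) b = distr \<mu> (onb_space hip) (\<lambda>R. \<chi> i. R *v axis i 1)"
    using b by (auto simp: uniform_random_onb_def)
  interpret haar_basis cj \<mu> i j by unfold_locales (rule \<mu>, rule ij)
  show "\<bar>covariance M (\<lambda>\<omega>. \<phi> (b \<omega> $ i)) (\<lambda>\<omega>. \<phi> (b \<omega> $ j))\<bar>
      \<le> 1 / (real CARD('n) - 1) * prob_space.variance uniform_sphere \<phi>"
    if "\<phi> \<in> L2_real uniform_sphere"
    using basis_cov_bound[OF that] covariance_uniform_onb[OF M that] sphere_cov_eq[OF that] by simp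
  let ?f = "\<lambda>x :: 'a ^ 'n. (norm (x $ j))\<^sup>2"
  have f: "?f \<in> L2_real usphere" by (intro continuous_L2_sphere continuous_intros)
  have "covariance M (\<lambda>\<omega>. ?f (b \<omega> $ i)) (\<lambda>\<omega>. ?f (b \<omega> $ j)) =
      - (1 / (real CARD('n) - 1) * prob_space.variance uniform_sphere ?f)"
    unfolding covariance_uniform_onb[OF M f] basis_cov_coordinate sphere_cov_eq[OF f] ..
  moreover have "0 \<le> 1 / (real CARD('n) - 1) * prob_space.variance uniform_sphere ?f"
    using card_ge_2 sphere.variance_positive[of ?f] by (intro mult_nonneg_nonneg) auto
  ultimately show "\<bar>covariance M (\<lambda>\<omega>. (norm (b \<omega> $ i $ j))\<^sup>2) (\<lambda>\<omega>. (norm (b \<omega> $ j $ j))\<^sup>2)\<bar>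
      = 1 / (real CARD('n) - 1) * prob_space.variance uniform_sphere ?f"
    by simp
qed

text \<open>One function, the squared modulus of a coordinate, serves all random bases. Positive
  variance excludes the trivial equality for constants.\<close>

lemma (in conj_field) uniform_onb_covariance_sharp:
  fixes i j :: "'n::finite"
  assumes ij: "i \<noteq> j"
  shows "\<exists>\<phi> \<in> L2_real (uniform_sphere :: ('a ^ 'n) measure).
    prob_space.variance uniform_sphere \<phi> > 0 \<and>
    (\<forall>(M :: 'w measure) b. uniform_random_onb (hip :: 'a ^ 'n \<Rightarrow> _) ugroup M b \<longrightarrow>
       \<bar>covariance M (\<lambda>\<omega>. \<phi> (b \<omega> $ i)) (\<lambda>\<omega>. \<phi> (b \<omega> $ j))\<bar>
         = 1 / (real CARD('n) - 1) * prob_space.variance uniform_sphere \<phi>)"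
proof -
  let ?f = "\<lambda>x :: 'a ^ 'n. (norm (x $ j))\<^sup>2"
  have f: "?f \<in> L2_real uniform_sphere"
    by (intro continuous_L2_sphere continuous_intros)
  show ?thesis
  proof (rule bexI[OF _ f], intro conjI allI impI)
    show "prob_space.variance uniform_sphere ?f > 0" by (rule variance_coordinate_pos[OF ij])
    fix M :: "'w measure" and b
    assume "uniform_random_onb (hip :: 'a ^ 'n \<Rightarrow> _) ugroup M b"
    from uniform_onb_covariance(2)[OF ij this]
    show "\<bar>covariance M (\<lambda>\<omega>. ?f (b \<omega> $ i)) (\<lambda>\<omega>. ?f (b \<omega> $ j))\<bar>
        = 1 / (real CARD('n) - 1) * prob_space.variance uniform_sphere ?f" .
  qed
qed

section \<open>Real and complex scalars as instances\<close>

lemma conj_field_real: "conj_field (\<lambda>x :: real. x)"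
  by unfold_locales (simp_all add: power2_eq_square)

lemma conj_field_cnj: "conj_field cnj"
  by unfold_locales (simp_all add: complex_norm_square mult.commute inner_complex_def del: of_real_power)

lemma hip_real: "conj_field.hip (\<lambda>x :: real. x) = inner"
  by (simp add: fun_eq_iff conj_field.hip_def[OF conj_field_real] inner_vec_def)

lemma ugroup_real: "conj_field.ugroup (\<lambda>x :: real. x) = orthogonal_group"
  by (simp add: conj_field.ugroup_def[OF conj_field_real] conj_field.adj_def[OF conj_field_real]
      orthogonal_group_def orthogonal_matrix_def transpose_def)

lemma hip_cnj: "conj_field.hip cnj = cinner_vec"
  by (simp add: fun_eq_iff conj_field.hip_def[OF conj_field_cnj] cinner_vec_def)

lemma ugroup_cnj: "conj_field.ugroup cnj = unitary_group"
  by (simp add: conj_field.ugroup_def[OF conj_field_cnj] conj_field.adj_def[OF conj_field_cnj]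
      unitary_group_def unitary_matrix_def adjoint_matrix_def)

theorem theorem2:
  fixes i j :: "'n::finite"
  assumes "CARD('n) \<ge> 4" and "i \<noteq> j"
  shows
    "(\<forall>(M :: 'w measure) (b :: 'w \<Rightarrow> real ^ 'n ^ 'n) \<phi>.
        uniform_random_onb inner orthogonal_group M b \<and> \<phi> \<in> L2_real uniform_sphere \<longrightarrow>
        \<bar>covariance M (\<lambda>\<omega>. \<phi> (b \<omega> $ i)) (\<lambda>\<omega>. \<phi> (b \<omega> $ j))\<bar>
          \<le> 1 / (real CARD('n) - 1) * prob_space.variance uniform_sphere \<phi>)
     \<and> (\<exists>\<phi> \<in> L2_real (uniform_sphere :: (real ^ 'n) measure).
        prob_space.variance uniform_sphere \<phi> > 0 \<and>
        (\<forall>(M :: 'w measure) (b :: 'w \<Rightarrow> real ^ 'n ^ 'n).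
           uniform_random_onb inner orthogonal_group M b \<longrightarrow>
           \<bar>covariance M (\<lambda>\<omega>. \<phi> (b \<omega> $ i)) (\<lambda>\<omega>. \<phi> (b \<omega> $ j))\<bar>
             = 1 / (real CARD('n) - 1) * prob_space.variance uniform_sphere \<phi>))
     \<and> (\<forall>(M :: 'w measure) (b :: 'w \<Rightarrow> complex ^ 'n ^ 'n) \<phi>.
        uniform_random_onb cinner_vec unitary_group M b \<and> \<phi> \<in> L2_real uniform_sphere \<longrightarrow>
        \<bar>covariance M (\<lambda>\<omega>. \<phi> (b \<omega> $ i)) (\<lambda>\<omega>. \<phi> (b \<omega> $ j))\<bar>
          \<le> 1 / (real CARD('n) - 1) * prob_space.variance uniform_sphere \<phi>)
     \<and> (\<exists>\<phi> \<in> L2_real (uniform_sphere :: (complex ^ 'n) measure).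
        prob_space.variance uniform_sphere \<phi> > 0 \<and>
        (\<forall>(M :: 'w measure) (b :: 'w \<Rightarrow> complex ^ 'n ^ 'n).
           uniform_random_onb cinner_vec unitary_group M b \<longrightarrow>
           \<bar>covariance M (\<lambda>\<omega>. \<phi> (b \<omega> $ i)) (\<lambda>\<omega>. \<phi> (b \<omega> $ j))\<bar>
             = 1 / (real CARD('n) - 1) * prob_space.variance uniform_sphere \<phi>))"
proof (intro conjI allI impI; (elim conjE)?)
  show "\<bar>covariance M (\<lambda>\<omega>. \<phi> (b \<omega> $ i)) (\<lambda>\<omega>. \<phi> (b \<omega> $ j))\<bar>
      \<le> 1 / (real CARD('n) - 1) * prob_space.variance uniform_sphere \<phi>"
    if "uniform_random_onb inner orthogonal_group M b" "\<phi> \<in> L2_real uniform_sphere"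
    for M :: "'w measure" and b :: "'w \<Rightarrow> real ^ 'n ^ 'n" and \<phi>
    using conj_field.uniform_onb_covariance(1)[OF conj_field_real assms(2), unfolded hip_real ugroup_real]
      that by blast
  show "\<bar>covariance M (\<lambda>\<omega>. \<phi> (b \<omega> $ i)) (\<lambda>\<omega>. \<phi> (b \<omega> $ j))\<bar>
      \<le> 1 / (real CARD('n) - 1) * prob_space.variance uniform_sphere \<phi>"
    if "uniform_random_onb cinner_vec unitary_group M b" "\<phi> \<in> L2_real uniform_sphere"
    for M :: "'w measure" and b :: "'w \<Rightarrow> complex ^ 'n ^ 'n" and \<phi>
    using conj_field.uniform_onb_covariance(1)[OF conj_field_cnj assms(2), unfolded hip_cnj ugroup_cnj]
      that by blast
qed (rule conj_field.uniform_onb_covariance_sharp[OF conj_field_real assms(2), unfolded hip_real ugroup_real],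
     rule conj_field.uniform_onb_covariance_sharp[OF conj_field_cnj assms(2), unfolded hip_cnj ugroup_cnj])

end
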